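(* Let $S=\mathfrak v\oplus\mathfrak z\times\mathbb R_+$ be the half-space model of a Damek--Ricci space, $n=\dim\mathfrak v$, $m=\dim\mathfrak z$, let $\mathfrak v=\mathfrak v_+\oplus\mathfrak v_-$ be an orthogonal decomposition into $\mathrm{Cl}(\mathfrak z,q)$-submodules with $n_\pm=\dim\mathfrak v_\pm$, let $v_0\in\mathfrak v$, $z_0\in\mathfrak z$, $\lambda>0$, and let $F\colon S\to\mathbb R$ be the isoparametric function $$F(v,z,t)=\frac1t\left(\left(t+\left\|\tfrac{v-v_0}2\right\|^2\right)^2+\left\|z-z_0+\tfrac12[v,v_0]\right\|^2+\lambda\langle v-v_0,(\Pi_{\mathfrak v_+}-\Pi_{\mathfrak v_-})(v-v_0)\rangle+4\lambda^2\right),$$ where $\Pi_{\mathfrak v_\pm}$ are the orthogonal projections onto $\mathfrak v_\pm$. Let $\Sigma_c=F^{-1}(c)$ be a regular level set of $F$, and let $r>0$ be its radius as a tube about the focal variety $\mathcal F$ of $F$. Then the trace $h$ of the Weingarten operator of $\Sigma_c$ with respect to the unit normal vector field $\nabla F/\|\nabla F\|$ equals $$h=-\left(m+\tfrac n2\right)\coth r-\tfrac12(n_+-n_-)\,\frac1{\sinh r}.$$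
   Context: Damek--Ricci data: $\mathfrak v,\mathfrak z$ are finite-dimensional real Euclidean vector spaces, and $J\colon\mathfrak z\to\mathrm{End}(\mathfrak v)$, $z\mapsto J_z$, is the linear map underlying a representation on $\mathfrak v$ of the Clifford algebra $\mathrm{Cl}(\mathfrak z,q)$, $q(z)=-\langle z,z\rangle$ (so $J_z^2=-\|z\|^2\mathrm{Id}$), such that $\|J_zv\|=\|z\|\|v\|$ for all $z,v$. A $\mathrm{Cl}(\mathfrak z,q)$-submodule of $\mathfrak v$ is a linear subspace invariant under all $J_z$. The skew-symmetric bilinear map $[\cdot,\cdot]\colon\mathfrak v\times\mathfrak v\to\mathfrak z$ is defined by $\langle[v_1,v_2],z\rangle=\langle J_zv_1,v_2\rangle$ for all $z\in\mathfrak z$. The half-space model of the Damek--Ricci space is $S=\mathfrak v\oplus\mathfrak z\times\mathbb R_+=\{(v,z,t): t>0\}$ with the Riemannian metric $$\langle(v_1,z_1,t_1),(v_2,z_2,t_2)\rangle_{(\bar v,\bar z,\bar t)}=\tfrac1{\bar t}\langle v_1,v_2\rangle+\tfrac1{\bar t^2}\left\langle z_1+\tfrac12[v_1,\bar v],z_2+\tfrac12[v_2,\bar v]\right\rangle+\tfrac{t_1t_2}{\bar t^2}.$$ A smooth function $F$ on a Riemannian manifold is isoparametric if $\Delta F=a\circ F$ and $\|\nabla F\|^2=b\circ F$ for a continuous $a$ and a $\mathcal C^2$ function $b$ on $\mathrm{im}\,F$; its focal varieties are its singular level sets. For the $F$ in the claim, the focal variety $\mathcal F$ is the level set of the minimal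 value $4\lambda$ of $F$, and every regular level set is a tube about $\mathcal F$, i.e. the set of points at a constant distance $r$ from $\mathcal F$. The Weingarten (shape) operator with respect to a unit normal field $\mathbf N$ is $X\mapsto-\nabla_X\mathbf N$. *)

theory Defs
  imports "HOL-Analysis.Analysis"
begin

text \<open>
  \<^bold>\<open>Riemannian geometry on an open subset \<open>S\<close> of a vector space.\<close>  All tangent spaces are
  identified with the vector space \<open>'a\<close> itself; a metric is a family \<open>g p\<close> of
  inner products on \<open>'a\<close>, and a vector field is a map \<open>'a \<Rightarrow> 'a\<close>.
\<close>

type_synonym 'a metric = "'a \<Rightarrow> 'a \<Rightarrow> 'a \<Rightarrow> real"

definition metric_norm :: "'a metric \<Rightarrow> 'a \<Rightarrow> 'a \<Rightarrow> real" where
  "metric_norm g p X = sqrt (g p X X)"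

definition gradient :: "'a::real_normed_vector metric \<Rightarrow> ('a \<Rightarrow> real) \<Rightarrow> 'a \<Rightarrow> 'a" where
  "gradient g F p = (THE w. \<forall>X. g p w X = frechet_derivative F (at p) X)"

text \<open>
  The Christoffel form of the Levi-Civita connection: \<open>christoffel g p X Y\<close> is the value at \<open>p\<close> of
  the covariant derivative of the constant field \<open>Y\<close> along the constant field \<open>X\<close>. It is given by the
  Koszul formula, in which the Lie bracket terms vanish because constant fields commute.
\<close>

definition christoffel :: "'a::real_normed_vector metric \<Rightarrow> 'a \<Rightarrow> 'a \<Rightarrow> 'a \<Rightarrow> 'a" where
  "christoffel g p X Y = (THE w. \<forall>Z. 2 * g p w Z =
       frechet_derivative (\<lambda>q. g q Y Z) (at p) X
     + frechet_derivative (\<lambda>q. g q X Z) (at p) Y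
     - frechet_derivative (\<lambda>q. g q X Y) (at p) Z)"

definition cov_deriv :: "'a::real_normed_vector metric \<Rightarrow> ('a \<Rightarrow> 'a) \<Rightarrow> 'a \<Rightarrow> 'a \<Rightarrow> 'a" where
  "cov_deriv g Y p X = frechet_derivative Y (at p) X + christoffel g p X (Y p)"

text \<open>
  Lengths are required to exist via \<open>has_integral\<close> (rather than using \<open>integral\<close>, which would
  assign length \<open>0\<close> to paths whose speed is not integrable).  This matters because
  \<^const>\<open>valid_path\<close> does not bound the derivative near the finitely many exceptional parameters.
\<close>

definition riemannian_dist :: "'a::real_normed_vector metric \<Rightarrow> 'a set \<Rightarrow> 'a \<Rightarrow> 'a \<Rightarrow> real" where
  "riemannian_dist g S p q = Inf {L. \<exists>\<gamma>. valid_path \<gamma> \<and> path_image \<gamma> \<subseteq> S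
      \<and> pathstart \<gamma> = p \<and> pathfinish \<gamma> = q
      \<and> ((\<lambda>s. metric_norm g (\<gamma> s) (vector_derivative \<gamma> (at s))) has_integral L) {0..1}}"

definition riemannian_dist_set :: "'a::real_normed_vector metric \<Rightarrow> 'a set \<Rightarrow> 'a \<Rightarrow> 'a set \<Rightarrow> real" where
  "riemannian_dist_set g S p A = (INF q\<in>A. riemannian_dist g S p q)"

definition tube :: "'a::real_normed_vector metric \<Rightarrow> 'a set \<Rightarrow> 'a set \<Rightarrow> real \<Rightarrow> 'a set" where
  "tube g S A r = {p \<in> S. riemannian_dist_set g S p A = r}"

definition level_set :: "'a set \<Rightarrow> ('a \<Rightarrow> real) \<Rightarrow> real \<Rightarrow> 'a set" where
  "level_set S F c = {p \<in> S. F p = c}"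

definition critical_point :: "('a::real_normed_vector \<Rightarrow> real) \<Rightarrow> 'a \<Rightarrow> bool" where
  "critical_point F p \<longleftrightarrow> (\<forall>X. frechet_derivative F (at p) X = 0)"

definition regular_level_set :: "'a::real_normed_vector set \<Rightarrow> ('a \<Rightarrow> real) \<Rightarrow> 'a set \<Rightarrow> bool" where
  "regular_level_set S F A \<longleftrightarrow>
     (\<exists>c \<in> F ` S. A = level_set S F c) \<and> (\<forall>p\<in>A. \<not> critical_point F p)"

text \<open>A focal variety of an isoparametric function is a singular level set.\<close>

definition focal_variety :: "'a::real_normed_vector set \<Rightarrow> ('a \<Rightarrow> real) \<Rightarrow> 'a set \<Rightarrow> bool" where
  "focal_variety S F A \<longleftrightarrow> (\<exists>c. A = level_set S F c) \<and> (\<exists>p\<in>A. critical_point F p)"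

definition tangent_space :: "('a::real_normed_vector \<Rightarrow> real) \<Rightarrow> 'a \<Rightarrow> 'a set" where
  "tangent_space F p = {X. frechet_derivative F (at p) X = 0}"

definition unit_normal :: "'a::real_normed_vector metric \<Rightarrow> ('a \<Rightarrow> real) \<Rightarrow> 'a \<Rightarrow> 'a" where
  "unit_normal g F p = gradient g F p /\<^sub>R metric_norm g p (gradient g F p)"

definition weingarten :: "'a::real_normed_vector metric \<Rightarrow> ('a \<Rightarrow> 'a) \<Rightarrow> 'a \<Rightarrow> 'a \<Rightarrow> 'a" where
  "weingarten g N p X = - cov_deriv g N p X"

text \<open>
  Trace of an endomorphism \<open>A\<close> of a finite-dimensional subspace \<open>W\<close>: the sum of the diagonal
  entries of its matrix with respect to a basis of \<open>W\<close> (the choice of which is immaterial).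
\<close>

definition trace_on :: "'a::real_vector set \<Rightarrow> ('a \<Rightarrow> 'a) \<Rightarrow> real" where
  "trace_on W A = (let B = (SOME B. independent B \<and> span B = W)
                   in \<Sum>b\<in>B. representation B (A b) b)"

text \<open>
  \<^bold>\<open>Damek--Ricci spaces.\<close>  The spaces \<open>'v\<close>, \<open>'z\<close> are of class
  \<^class>\<open>real_inner\<close> with a finite spanning set, instead of class \<^class>\<open>euclidean_space\<close>, so
  that zero-dimensional spaces are not excluded.  By the universal property of the Clifford algebra
  of \<open>('z, q)\<close>, \<open>q z = - (z \<bullet> z)\<close>, its representations on \<open>'v\<close> are exactly the
  linear maps \<open>z \<mapsto> J z\<close> into the endomorphisms with \<open>J z \<circ> J z = q z \<cdot> id\<close>.
\<close>

definition finite_dimensional :: "'a::real_vector set \<Rightarrow> bool" where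
  "finite_dimensional W \<longleftrightarrow> (\<exists>B. finite B \<and> span B = W)"

definition clifford_rep :: "('z::real_inner \<Rightarrow> 'v::real_vector \<Rightarrow> 'v) \<Rightarrow> bool" where
  "clifford_rep J \<longleftrightarrow> bilinear J \<and> (\<forall>z v. J z (J z v) = (- (z \<bullet> z)) *\<^sub>R v)"

definition damek_ricci_data :: "('z::real_inner \<Rightarrow> 'v::real_inner \<Rightarrow> 'v) \<Rightarrow> bool" where
  "damek_ricci_data J \<longleftrightarrow>
     finite_dimensional (UNIV :: 'v set) \<and> finite_dimensional (UNIV :: 'z set)
     \<and> clifford_rep J \<and> (\<forall>z v. norm (J z v) = norm z * norm v)"

definition clifford_submodule :: "('z::real_inner \<Rightarrow> 'v::real_vector \<Rightarrow> 'v) \<Rightarrow> 'v set \<Rightarrow> bool" where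
  "clifford_submodule J W \<longleftrightarrow> subspace W \<and> (\<forall>z. \<forall>w\<in>W. J z w \<in> W)"

definition orthogonal_decomposition :: "'v::real_inner set \<Rightarrow> 'v set \<Rightarrow> bool" where
  "orthogonal_decomposition V W \<longleftrightarrow>
     (\<forall>x\<in>V. \<forall>y\<in>W. orthogonal x y) \<and> (\<forall>v. \<exists>x\<in>V. \<exists>y\<in>W. v = x + y)"

definition orth_proj :: "'v::real_inner set \<Rightarrow> 'v \<Rightarrow> 'v" where
  "orth_proj W v = (THE x. x \<in> W \<and> (\<forall>w\<in>W. orthogonal (v - x) w))"

definition lie_bracket :: "('z::real_inner \<Rightarrow> 'v::real_inner \<Rightarrow> 'v) \<Rightarrow> 'v \<Rightarrow> 'v \<Rightarrow> 'z" where
  "lie_bracket J v1 v2 = (THE w. \<forall>z. w \<bullet> z = J z v1 \<bullet> v2)"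

definition half_space :: "('v \<times> 'z \<times> real) set" where
  "half_space = {(v, z, t). t > 0}"

definition dr_metric ::
    "('z::real_inner \<Rightarrow> 'v::real_inner \<Rightarrow> 'v) \<Rightarrow> ('v \<times> 'z \<times> real) metric" where
  "dr_metric J = (\<lambda>(vb, zb, tb) (v1, z1, t1) (v2, z2, t2).
       (v1 \<bullet> v2) / tb
     + ((z1 + (1/2) *\<^sub>R lie_bracket J v1 vb) \<bullet> (z2 + (1/2) *\<^sub>R lie_bracket J v2 vb)) / tb\<^sup>2
     + t1 * t2 / tb\<^sup>2)"

definition isoparam_fun ::
    "('z::real_inner \<Rightarrow> 'v::real_inner \<Rightarrow> 'v) \<Rightarrow> 'v set \<Rightarrow> 'v set \<Rightarrow> 'v \<Rightarrow> 'z \<Rightarrow> real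
      \<Rightarrow> 'v \<times> 'z \<times> real \<Rightarrow> real" where
  "isoparam_fun J Vp Vm v0 z0 lam = (\<lambda>(v, z, t).
     (1 / t) * ((t + (norm ((v - v0) /\<^sub>R 2))\<^sup>2)\<^sup>2
       + (norm (z - z0 + (1/2) *\<^sub>R lie_bracket J v v0))\<^sup>2
       + lam * ((v - v0) \<bullet> (orth_proj Vp (v - v0) - orth_proj Vm (v - v0)))
       + 4 * lam\<^sup>2))"

definition coth :: "real \<Rightarrow> real" where
  "coth x = cosh x / sinh x"

end

theory Submission
  imports Defs
begin

text \<open>
  Since \<open>|grad F|\<^sup>2 = F\<^sup>2 - 16 \<lambda>\<^sup>2\<close>, the function \<open>arcosh (F / (4 \<lambda>))\<close> has unit gradient where it is smooth,
  so it bounds the distance to the focal variety \<open>F = 4 \<lambda>\<close> from below; equality holds on the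
  vertical geodesic through \<open>(v0, z0, 2 \<lambda>)\<close>, which meets every level set. Hence \<open>F = 4 \<lambda> cosh r\<close>
  on the level set of radius \<open>r\<close>.
  The trace of the Weingarten operator is \<open>- div N\<close>, because \<open>\<nabla>N\<close> takes values in the tangent
  space of the level set. In the half-space coordinates \<open>div N\<close> is the flat divergence of \<open>N\<close> plus the
  derivative along \<open>N\<close> of the logarithm of the density \<open>t\<close> to the power \<open>-(n/2 + m + 1)\<close>, and
  \<open>N = grad F / |grad F|\<close> with \<open>grad F\<close> polynomial.
\<close>

subsection \<open>Orthonormal bases and traces\<close>

text \<open>The submodule hypothesis enters through the involution \<open>sig\<close>, the
  difference of the two projections. It commutes with every \<open>J z\<close>, so
  \<open>sig w\<close> is orthogonal to all \<open>J z w\<close> and its bracket with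
  \<open>w\<close> vanishes. Together with the formula for \<open>br (J z w) w\<close> this removes
  the cross terms in the gradient and leaves \<open>16 * lam\<^sup>2\<close> as the only remainder
  in its squared norm.

  The radius needs no description of the tubes: the tube equation at one point of the level set
  already fixes cosh r. On the vertical line F is t + 4 lam^2 / t, which at t = 2 lam e^s equals 4
  lam cosh s.

  \<open>trace_on\<close> picks a basis by choice, while gradient and connection are definite
  descriptions, so basis independence and unique representability of linear forms have to be
  available before any geometry. The trace over the tangent space is extended to the whole vector
  space, where the covariant derivative splits into a rank-one term, a flat divergence and a
  Christoffel term. The quantity t + |w|^2 / 4 cancels between the last two, which leaves a function
  of F alone.\<close>

lemma finite_dimensional_subspace:
  assumes "finite_dimensional (UNIV :: 'a::real_vector set)" and "subspace (W :: 'a set)"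
  shows "finite_dimensional W"
proof -
  obtain C :: "'a set" where C: "finite C" "span C = UNIV"
    using assms(1) by (auto simp: finite_dimensional_def)
  obtain B where B: "B \<subseteq> W" "independent B" "W \<subseteq> span B" "card B = dim W"
    using basis_exists by blast
  have "finite B"
    using independent_span_bound[OF C(1) B(2)] C(2) by auto
  moreover have "span B = W"
    using B(1,3) assms(2) by (simp add: span_minimal subset_antisym)
  ultimately show ?thesis
    by (auto simp: finite_dimensional_def)
qed

definition orthonormal :: "'a::real_inner set \<Rightarrow> bool" where
  "orthonormal U \<longleftrightarrow> (\<forall>u\<in>U. \<forall>w\<in>U. u \<bullet> w = (if u = w then 1 else 0))"

lemma orthonormal_basis_exists:
  fixes W :: "'a::real_inner set"
  assumes "finite_dimensional W"
  obtains U where "finite U" "orthonormal U" "span U = W"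
proof -
  obtain B where B: "finite B" "span B = W"
    using assms by (auto simp: finite_dimensional_def)
  then obtain C where C: "finite C" "span C = W" "pairwise orthogonal C"
    using basis_orthogonal[OF B(1)] by auto
  define U where "U = (\<lambda>x. x /\<^sub>R norm x) ` (C - {0})"
  have "finite U"
    using C(1) by (simp add: U_def)
  moreover have "orthonormal U"
    unfolding orthonormal_def
  proof (intro ballI)
    fix u w assume "u \<in> U" "w \<in> U"
    then obtain x y where xy: "x \<in> C" "y \<in> C" "x \<noteq> 0" "y \<noteq> 0" "u = x /\<^sub>R norm x" "w = y /\<^sub>R norm y"
      by (auto simp: U_def)
    have "w \<bullet> w = 1"
      using xy by (simp flip: power2_norm_eq_inner)
    moreover have "u \<bullet> w = 0" if "x \<noteq> y"
      using C(3) xy that by (simp add: pairwise_def orthogonal_def)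
    ultimately show "u \<bullet> w = (if u = w then 1 else 0)"
      using xy by (metis zero_neq_one)
  qed
  moreover have "span U = span (C - {0})"
  proof
    show "span U \<subseteq> span (C - {0})"
      by (rule span_minimal) (auto simp: U_def intro: span_scale span_base)
    have "x \<in> span U" if "x \<in> C - {0}" for x
    proof -
      have "norm x *\<^sub>R (x /\<^sub>R norm x) \<in> span U"
        by (rule span_scale, rule span_base) (use that in \<open>auto simp: U_def\<close>)
      then show ?thesis
        using that by simp
    qed
    then show "span (C - {0}) \<subseteq> span U"
      by (intro span_minimal) auto
  qed
  ultimately show thesis
    using that C(2) by (simp add: span_delete_0)
qed

lemma orthonormal_independent:
  assumes "finite U" "orthonormal U"
  shows "independent U"
proof -
  have "0 \<notin> U"
    using assms(2) by (force simp: orthonormal_def)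
  moreover have "pairwise orthogonal U"
    using assms(2) by (auto simp: orthonormal_def pairwise_def orthogonal_def)
  ultimately show ?thesis
    by (simp add: pairwise_orthogonal_independent)
qed

lemma orthonormal_card:
  assumes "finite U" "orthonormal U"
  shows "dim (span U) = card U"
  using dim_eq_card[OF _ orthonormal_independent[OF assms], of U] by simp

lemma orthonormal_expand:
  assumes U: "finite U" "orthonormal U" and x: "x \<in> span U"
  shows "(\<Sum>u\<in>U. (x \<bullet> u) *\<^sub>R u) = x"
proof -
  define y where "y = x - (\<Sum>u\<in>U. (x \<bullet> u) *\<^sub>R u)"
  have "y \<bullet> w = 0" if "w \<in> U" for w
  proof -
    have "(\<Sum>u\<in>U. (x \<bullet> u) * (u \<bullet> w)) = (\<Sum>u\<in>U. if u = w then x \<bullet> w else 0)"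
      using U(2) that by (intro sum.cong) (auto simp: orthonormal_def)
    then show ?thesis
      using U(1) that by (simp add: y_def inner_diff_left inner_sum_left)
  qed
  then have "\<And>w. w \<in> span U \<Longrightarrow> y \<bullet> w = 0"
    by (metis orthogonal_def orthogonal_to_span)
  moreover have "y \<in> span U"
    unfolding y_def by (intro span_diff x span_sum span_scale span_base)
  ultimately have "y \<bullet> y = 0"
    by blast
  then show ?thesis
    by (simp add: y_def)
qed

lemma orthonormal_Parseval:
  assumes "finite U" "orthonormal U" "x \<in> span U"
  shows "(\<Sum>u\<in>U. (x \<bullet> u) * (y \<bullet> u)) = x \<bullet> y"
proof -
  have "x \<bullet> y = (\<Sum>u\<in>U. (x \<bullet> u) *\<^sub>R u) \<bullet> y"
    using orthonormal_expand[OF assms] by simp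
  also have "\<dots> = (\<Sum>u\<in>U. (x \<bullet> u) * (u \<bullet> y))"
    by (simp add: inner_sum_left)
  finally show ?thesis
    by (simp add: inner_commute)
qed

lemma orthonormal_linear_Riesz:
  fixes f :: "'a::real_inner \<Rightarrow> real"
  assumes U: "finite U" "orthonormal U" "span U = UNIV" and f: "linear f"
  shows "(\<Sum>u\<in>U. f u *\<^sub>R u) \<bullet> x = f x"
proof -
  have "f x = f (\<Sum>u\<in>U. (x \<bullet> u) *\<^sub>R u)"
    using orthonormal_expand[OF U(1,2)] U(3) by simp
  also have "\<dots> = (\<Sum>u\<in>U. f u * (u \<bullet> x))"
    by (simp add: linear_sum[OF f] linear_cmul[OF f] mult.commute inner_commute)
  finally show ?thesis
    by (simp add: inner_sum_left)
qed

lemma linear_functional_Riesz: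
  fixes f :: "'a::real_inner \<Rightarrow> real"
  assumes fd: "finite_dimensional (UNIV :: 'a set)" and f: "linear f"
  shows "\<exists>w. \<forall>x. w \<bullet> x = f x"
proof -
  obtain U :: "'a set" where "finite U" "orthonormal U" "span U = UNIV"
    using orthonormal_basis_exists[OF fd] .
  then show ?thesis
    using orthonormal_linear_Riesz f by blast
qed

lemma orthonormal_Un:
  assumes U: "finite U" "orthonormal U" and U': "finite U'" "orthonormal U'"
    and orth: "\<And>u u'. u \<in> U \<Longrightarrow> u' \<in> U' \<Longrightarrow> u \<bullet> u' = 0"
  shows "orthonormal (U \<union> U')" "U \<inter> U' = {}"
proof -
  show "U \<inter> U' = {}"
    using orth U(2) by (fastforce simp: orthonormal_def)
  then show "orthonormal (U \<union> U')"
    using U(2) U'(2) orth unfolding orthonormal_def by (metis Un_iff disjoint_iff inner_commute)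
qed

text \<open>Bases are sets that may be empty, because either of the first two factors may be
  zero-dimensional; only the last coordinate is always present.\<close>

definition prod_basis :: "'a::real_inner set \<Rightarrow> 'b::real_inner set \<Rightarrow> ('a \<times> 'b \<times> real) set" where
  "prod_basis A B = (\<lambda>a. (a, 0, 0)) ` A \<union> (\<lambda>b. (0, b, 0)) ` B \<union> {(0, 0, 1)}"

lemma prod_basis_orthonormal:
  fixes A :: "'a::real_inner set" and B :: "'b::real_inner set"
  assumes A: "finite A" "orthonormal A" "span A = UNIV"
    and B: "finite B" "orthonormal B" "span B = UNIV"
  shows "finite (prod_basis A B)" "orthonormal (prod_basis A B)" "span (prod_basis A B) = UNIV"
    "(\<Sum>u\<in>prod_basis A B. f u) = (\<Sum>a\<in>A. f (a, 0, 0)) + (\<Sum>b\<in>B. f (0, b, 0)) + f (0, 0, 1)"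
proof -
  have nz: "0 \<notin> A" "0 \<notin> B"
    using A(2) B(2) by (force simp: orthonormal_def)+
  show "finite (prod_basis A B)"
    using A(1) B(1) by (simp add: prod_basis_def)
  show "orthonormal (prod_basis A B)"
  proof -
    have "\<And>a a'. a \<in> A \<Longrightarrow> a' \<in> A \<Longrightarrow> a \<bullet> a' = (if a = a' then 1 else 0)"
      "\<And>b b'. b \<in> B \<Longrightarrow> b' \<in> B \<Longrightarrow> b \<bullet> b' = (if b = b' then 1 else 0)"
      using A(2) B(2) by (auto simp: orthonormal_def)
    then show ?thesis
      using nz by (auto simp: orthonormal_def prod_basis_def split: if_splits)
  qed
  have "(x, y, s) \<in> span (prod_basis A B)" for x y s
  proof -
    have linA: "linear (\<lambda>a::'a. (a, 0::'b, 0::real))" and linB: "linear (\<lambda>b::'b. (0::'a, b, 0::real))"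
      by (auto intro!: linearI)
    have "(x, 0::'b, 0::real) \<in> span ((\<lambda>a. (a, 0, 0)) ` A)"
      unfolding linear_span_image[OF linA] A(3) by simp
    then have 1: "(x, 0, 0) \<in> span (prod_basis A B)"
      by (rule rev_subsetD[OF _ span_mono]) (auto simp: prod_basis_def)
    have "(0::'a, y, 0::real) \<in> span ((\<lambda>b. (0, b, 0)) ` B)"
      unfolding linear_span_image[OF linB] B(3) by simp
    then have 2: "(0, y, 0) \<in> span (prod_basis A B)"
      by (rule rev_subsetD[OF _ span_mono]) (auto simp: prod_basis_def)
    have 3: "s *\<^sub>R (0, 0, 1) \<in> span (prod_basis A B)"
      by (intro span_scale span_base) (simp add: prod_basis_def)
    show ?thesis
      using span_add[OF span_add[OF 1 2] 3] by simp
  qed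
  then show "span (prod_basis A B) = UNIV"
    by auto
  have "(\<Sum>u\<in>prod_basis A B. f u) = (\<Sum>u\<in>(\<lambda>a. (a, 0, 0)) ` A. f u)
      + (\<Sum>u\<in>(\<lambda>b. (0, b, 0)) ` B. f u) + (\<Sum>u\<in>{(0, 0, 1)}. f u)"
    unfolding prod_basis_def using A(1) B(1) nz
    by (subst sum.union_disjoint; (auto; fail)?)+
  then show "(\<Sum>u\<in>prod_basis A B. f u)
      = (\<Sum>a\<in>A. f (a, 0, 0)) + (\<Sum>b\<in>B. f (0, b, 0)) + f (0, 0, 1)"
    by (simp add: sum.reindex inj_on_def)
qed

text \<open>Basis independence frees \<open>trace_on\<close> from the basis chosen by
  \<open>SOME\<close>. Expanding each b in C and each A c in B turns both traces into the same
  double sum, with the order of summation exchanged; invariance of W keeps every A c in the common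
  span.\<close>

lemma trace_on_eq_sum_representation:
  fixes A :: "'a::real_vector \<Rightarrow> 'a"
  assumes B: "finite B" "independent B" "span B = W"
    and A: "linear A" "\<And>x. x \<in> W \<Longrightarrow> A x \<in> W"
  shows "trace_on W A = (\<Sum>b\<in>B. representation B (A b) b)"
proof -
  define C where "C = (SOME B. independent B \<and> span B = W)"
  have C: "independent C" "span C = W"
    using someI[of "\<lambda>B. independent B \<and> span B = W" B] B by (auto simp: C_def)
  have "C \<subseteq> span B"
    using C(2) B(3) span_superset by blast
  then have finC: "finite C"
    using independent_span_bound[OF B(1) C(1)] by blast
  have BW: "b \<in> W" if "b \<in> B" for b
    using that B(3) span_base by blast
  have CW: "c \<in> W" if "c \<in> C" for c
    using that C(2) span_base by blast
  have 1: "representation B (A b) b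
      = (\<Sum>c\<in>C. representation C b c * representation B (A c) b)" if "b \<in> B" for b
  proof -
    have "A b = A (\<Sum>c\<in>C. representation C b c *\<^sub>R c)"
      using sum_representation_eq[OF C(1) _ finC, of b] BW[OF that] C(2) by simp
    also have "\<dots> = (\<Sum>c\<in>C. representation C b c *\<^sub>R A c)"
      by (simp add: linear_sum[OF A(1)] linear_cmul[OF A(1)])
    finally have "representation B (A b)
        = (\<lambda>b'. \<Sum>c\<in>C. representation B (representation C b c *\<^sub>R A c) b')"
      using representation_sum[OF B(2), of C "\<lambda>c. representation C b c *\<^sub>R A c"] A(2) CW B(3)
        span_scale[of _ B] by simp
    then show ?thesis
      using A(2) CW B(3) by (simp add: representation_scale[OF B(2)])
  qed
  have 2: "(\<Sum>b\<in>B. representation C b c * representation B (A c) b) = representation C (A c) c"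
    if "c \<in> C" for c
  proof -
    have "A c = (\<Sum>b\<in>B. representation B (A c) b *\<^sub>R b)"
      using sum_representation_eq[OF B(2) _ B(1), of "A c"] A(2)[OF CW[OF that]] B(3) by simp
    then have "representation C (A c)
        = (\<lambda>c'. \<Sum>b\<in>B. representation C (representation B (A c) b *\<^sub>R b) c')"
      using representation_sum[OF C(1), of B "\<lambda>b. representation B (A c) b *\<^sub>R b"] BW C(2)
        span_scale[of _ C] by simp
    then show ?thesis
      using BW C(2) by (simp add: representation_scale[OF C(1)] mult.commute)
  qed
  have "(\<Sum>b\<in>B. representation B (A b) b)
      = (\<Sum>b\<in>B. \<Sum>c\<in>C. representation C b c * representation B (A c) b)"
    using 1 by simp
  also have "\<dots> = (\<Sum>c\<in>C. \<Sum>b\<in>B. representation C b c * representation B (A c) b)"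
    by (rule sum.swap)
  also have "\<dots> = (\<Sum>c\<in>C. representation C (A c) c)"
    using 2 by simp
  finally show ?thesis
    by (simp add: trace_on_def Let_def C_def)
qed

text \<open>A basis of the hyperplane is completed by the transversal vector N. Since A maps
  everything into W, A N has no N-component, so the additional diagonal entry is 0.\<close>

lemma trace_on_hyperplane:
  fixes A :: "'a::real_vector \<Rightarrow> 'a"
  assumes fd: "finite_dimensional (UNIV :: 'a set)"
    and f: "linear f" "f N \<noteq> (0::real)" and W: "W = {x. f x = 0}"
    and A: "linear A" "\<And>x. A x \<in> W"
  shows "trace_on W A = trace_on UNIV A"
proof -
  have subW: "subspace W"
    using f(1) by (auto simp: W subspace_def linear_0 linear_add linear_cmul)
  obtain C where C: "finite C" "span C = W"
    using finite_dimensional_subspace[OF fd subW] by (auto simp: finite_dimensional_def)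
  obtain B where B: "B \<subseteq> C" "independent B" "C \<subseteq> span B"
    using maximal_independent_subset[of C] by blast
  have finB: "finite B"
    using B(1) C(1) finite_subset by blast
  have spB: "span B = W"
    using B(1,3) C(2) by (metis span_mono span_span subset_antisym)
  have NW: "N \<notin> W"
    using f(2) by (simp add: W)
  then have NB: "N \<notin> B"
    using spB span_base by blast
  have ind: "independent (insert N B)"
    using NW B(2) spB by (simp add: independent_insert)
  have sp: "span (insert N B) = UNIV"
  proof -
    have "x \<in> span (insert N B)" for x
    proof -
      have "x - (f x / f N) *\<^sub>R N \<in> W"
        using f by (simp add: W linear_diff linear_cmul)
      then have "x - (f x / f N) *\<^sub>R N \<in> span (insert N B)"
        using spB span_mono[of B "insert N B"] by blast
      moreover have "(f x / f N) *\<^sub>R N \<in> span (insert N B)"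
        by (simp add: span_base span_scale)
      ultimately have "(x - (f x / f N) *\<^sub>R N) + (f x / f N) *\<^sub>R N \<in> span (insert N B)"
        by (rule span_add)
      then show ?thesis
        by simp
    qed
    then show ?thesis
      by blast
  qed
  have rep: "representation (insert N B) (A b) = representation B (A b)" for b
    using representation_extend[OF ind, of "A b" B] A(2) spB by auto
  have "representation B (A N) N = 0"
    using NB representation_ne_zero by blast
  moreover have "trace_on UNIV A = (\<Sum>b\<in>insert N B. representation (insert N B) (A b) b)"
    using trace_on_eq_sum_representation[OF _ ind sp A(1)] finB by simp
  moreover have "trace_on W A = (\<Sum>b\<in>B. representation B (A b) b)"
    using trace_on_eq_sum_representation[OF finB B(2) spB A(1)] A(2) by simp
  ultimately show ?thesis
    using finB NB by (simp add: rep)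
qed

text \<open>The images S u form a basis whose coordinate functions are the inner products of T x
  with u. With T a coframe and S the matching frame, this computes a trace in an orthonormal frame
  of the metric.\<close>

lemma trace_on_UNIV_orthonormal:
  fixes A :: "'a::real_vector \<Rightarrow> 'a" and T :: "'a \<Rightarrow> 'b::real_inner"
  assumes U: "finite U" "orthonormal U" "span U = UNIV"
    and T: "linear T" and S: "linear S" and inv: "\<And>x. T (S x) = x" "\<And>x. S (T x) = x"
    and A: "linear A"
  shows "trace_on UNIV A = (\<Sum>u\<in>U. T (A (S u)) \<bullet> u)"
proof -
  have injS: "inj S"
    by (metis inv(1) injI)
  have injSU: "inj_on S U"
    using injS inj_on_subset by blast
  have ind: "independent (S ` U)"
    using linear_independent_injective_image[OF S orthonormal_independent[OF U(1,2)]] injS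
      inj_on_subset by blast
  have sp: "span (S ` U) = UNIV"
    using linear_span_image[OF S, of U] U(3) by (metis inv(2) surjI)
  have "representation (S ` U) x (S u) = T x \<bullet> u" if "u \<in> U" for x u
  proof -
    have "x = S (\<Sum>w\<in>U. (T x \<bullet> w) *\<^sub>R w)"
      using orthonormal_expand[OF U(1,2), of "T x"] U(3) inv(2) by simp
    also have "\<dots> = (\<Sum>w\<in>U. (T x \<bullet> w) *\<^sub>R S w)"
      by (simp add: linear_sum[OF S] linear_cmul[OF S])
    finally have "representation (S ` U) x
        = (\<lambda>b. \<Sum>w\<in>U. representation (S ` U) ((T x \<bullet> w) *\<^sub>R S w) b)"
      using representation_sum[OF ind, of U "\<lambda>w. (T x \<bullet> w) *\<^sub>R S w"] sp by simp
    then have "representation (S ` U) x (S u)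
        = (\<Sum>w\<in>U. (T x \<bullet> w) * representation (S ` U) (S w) (S u))"
      by (simp add: representation_scale[OF ind] sp)
    also have "\<dots> = (\<Sum>w\<in>U. if w = u then T x \<bullet> u else 0)"
      using injS by (intro sum.cong) (auto simp: representation_basis[OF ind] inj_eq)
    finally show ?thesis
      using that U(1) by simp
  qed
  then show ?thesis
    using trace_on_eq_sum_representation[OF _ ind sp A] U(1) by (simp add: sum.reindex[OF injSU])
qed

lemma trace_on_UNIV_add:
  fixes A B :: "'a::real_inner \<Rightarrow> 'a"
  assumes fd: "finite_dimensional (UNIV :: 'a set)" and A: "linear A" and B: "linear B"
  shows "trace_on UNIV (\<lambda>x. A x + B x) = trace_on UNIV A + trace_on UNIV B"
proof -
  obtain U :: "'a set" where U: "finite U" "orthonormal U" "span U = UNIV"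
    using orthonormal_basis_exists[OF fd] .
  note trace = trace_on_UNIV_orthonormal[OF U linear_id linear_id, simplified]
  show ?thesis
    by (simp add: trace A B linear_compose_add inner_add_left sum.distrib)
qed

lemma trace_on_UNIV_scaleR:
  fixes A :: "'a::real_inner \<Rightarrow> 'a"
  assumes fd: "finite_dimensional (UNIV :: 'a set)" and A: "linear A"
  shows "trace_on UNIV (\<lambda>x. c *\<^sub>R A x) = c * trace_on UNIV A"
proof -
  obtain U :: "'a set" where U: "finite U" "orthonormal U" "span U = UNIV"
    using orthonormal_basis_exists[OF fd] .
  note trace = trace_on_UNIV_orthonormal[OF U linear_id linear_id, simplified]
  show ?thesis
    by (simp add: trace A linear_compose_scale_right sum_distrib_left)
qed

text \<open>Intended for the term of the covariant derivative of the unit normal that comes from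
  differentiating 1 / |grad F|.\<close>

lemma trace_on_UNIV_rank_one:
  fixes f :: "'a::real_inner \<Rightarrow> real"
  assumes fd: "finite_dimensional (UNIV :: 'a set)" and f: "linear f"
  shows "trace_on UNIV (\<lambda>x. f x *\<^sub>R c) = f c"
proof -
  obtain U :: "'a set" where U: "finite U" "orthonormal U" "span U = UNIV"
    using orthonormal_basis_exists[OF fd] .
  note trace = trace_on_UNIV_orthonormal[OF U linear_id linear_id, simplified]
  have "linear (\<lambda>x. f x *\<^sub>R c)"
    using f by (intro linearI) (simp_all add: linear_add linear_cmul algebra_simps)
  then have "trace_on UNIV (\<lambda>x. f x *\<^sub>R c) = (\<Sum>u\<in>U. f u * (u \<bullet> c))"
    by (simp add: trace inner_commute)
  also have "\<dots> = (\<Sum>u\<in>U. f u *\<^sub>R u) \<bullet> c"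
    by (simp add: inner_sum_left)
  finally show ?thesis
    by (simp add: orthonormal_linear_Riesz[OF U f])
qed

subsection \<open>The metric and its Levi-Civita connection\<close>

lemma open_half_space: "open (half_space :: ('a::topological_space \<times> 'b::topological_space \<times> real) set)"
proof -
  have "half_space = {q :: 'a \<times> 'b \<times> real. 0 < snd (snd q)}"
    by (auto simp: half_space_def)
  also have "open \<dots>"
    by (intro open_Collect_less continuous_intros)
  finally show ?thesis .
qed

section \<open>Clifford action and Lie bracket\<close>

locale damek_ricci =
  fixes J :: "'z::real_inner \<Rightarrow> 'v::real_inner \<Rightarrow> 'v"
  assumes data: "damek_ricci_data J"
begin

abbreviation br :: "'v \<Rightarrow> 'v \<Rightarrow> 'z" where
  "br \<equiv> lie_bracket J"

lemma finite_dimensional_v: "finite_dimensional (UNIV :: 'v set)"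
  and finite_dimensional_z: "finite_dimensional (UNIV :: 'z set)"
  and J_square: "J z (J z v) = (- (z \<bullet> z)) *\<^sub>R v"
  and norm_J: "norm (J z v) = norm z * norm v"
  using data by (auto simp: damek_ricci_data_def clifford_rep_def)

sublocale J: bounded_bilinear J
proof
  have "bilinear J"
    using data by (simp add: damek_ricci_data_def clifford_rep_def)
  then show "J (a + a') b = J a b + J a' b" "J a (b + b') = J a b + J a b'"
    "J (r *\<^sub>R a) b = r *\<^sub>R J a b" "J a (r *\<^sub>R b) = r *\<^sub>R J a b" for a a' b b' r
    by (simp_all add: bilinear_ladd bilinear_radd bilinear_lmul bilinear_rmul)
  show "\<exists>K. \<forall>a b. norm (J a b) \<le> norm a * norm b * K"
    by (intro exI[of _ 1]) (simp add: norm_J)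
qed

lemma J_inner_J_same: "J z v \<bullet> J z v = (z \<bullet> z) * (v \<bullet> v)"
  by (simp add: norm_J power_mult_distrib flip: power2_norm_eq_inner)

lemma J_inner_J_left: "J z u \<bullet> J z w = (z \<bullet> z) * (u \<bullet> w)"
  using J_inner_J_same[of z "u + w"] J_inner_J_same[of z u] J_inner_J_same[of z w]
  by (simp add: J.add_right inner_simps inner_commute algebra_simps)

lemma J_inner_J_right: "J z v \<bullet> J y v = (z \<bullet> y) * (v \<bullet> v)"
  using J_inner_J_same[of "z + y" v] J_inner_J_same[of z v] J_inner_J_same[of y v]
  by (simp add: J.add_left inner_simps inner_commute algebra_simps)

text \<open>Skewness follows from the polarised norm identity with \<open>J z w\<close> in the
  second slot, because \<open>J z\<close> squares to a negative multiple of the identity; the factor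
  \<open>z \<bullet> z\<close> is cancelled when z is nonzero.\<close>

lemma J_skew: "J z u \<bullet> w = - (u \<bullet> J z w)"
proof (cases "z = 0")
  case True
  then show ?thesis
    by (simp add: J.zero_left)
next
  case False
  have "(z \<bullet> z) * (J z u \<bullet> w) = (z \<bullet> z) * - (u \<bullet> J z w)"
    using J_inner_J_left[of z u "J z w"] by (simp add: J_square)
  then show ?thesis
    using False by (metis inner_eq_zero_iff mult_left_cancel)
qed

lemma J_self: "J z v \<bullet> v = 0"
  using J_skew[of z v v] by (simp add: inner_commute)

lemma br_inner: "br u w \<bullet> z = J z u \<bullet> w"
proof -
  have "linear (\<lambda>z. J z u \<bullet> w)"
    by (intro linearI) (simp_all add: J.add_left J.scaleR_left inner_simps)
  then obtain x where x: "\<forall>z. x \<bullet> z = J z u \<bullet> w"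
    using linear_functional_Riesz[OF finite_dimensional_z] by blast
  have "\<forall>z. br u w \<bullet> z = J z u \<bullet> w"
    unfolding lie_bracket_def using x by (rule theI) (metis x vector_eq_rdot)
  then show ?thesis
    by simp
qed

sublocale br: bounded_bilinear br
proof
  show "br (a + a') b = br a b + br a' b" "br a (b + b') = br a b + br a b'"
    "br (r *\<^sub>R a) b = r *\<^sub>R br a b" "br a (r *\<^sub>R b) = r *\<^sub>R br a b" for a a' b b' r
    by (subst vector_eq_rdot[symmetric];
        simp add: br_inner inner_simps J.add_right J.scaleR_right)+
  have "norm (br a b) \<le> norm a * norm b" for a b
  proof (cases "br a b = 0")
    case False
    have "norm (br a b) * norm (br a b) = J (br a b) a \<bullet> b"
      by (simp flip: br_inner power2_norm_eq_inner power2_eq_square)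
    also have "\<dots> \<le> norm (br a b) * (norm a * norm b)"
      using norm_cauchy_schwarz[of "J (br a b) a" b] by (simp add: norm_J mult.assoc)
    finally show ?thesis
      using False by simp
  qed simp
  then show "\<exists>K. \<forall>a b. norm (br a b) \<le> norm a * norm b * K"
    by (intro exI[of _ 1]) simp
qed

lemma br_self: "br v v = 0"
  by (subst vector_eq_rdot[symmetric]) (simp add: br_inner J_self)

text \<open>Testing against y gives the inner product of \<open>J y (J z v)\<close> with v, which
  skewness turns into the polarised norm identity in the Clifford variable. This is the only bracket
  that survives in the gradient of F.\<close>

lemma br_J: "br (J z v) v = - (v \<bullet> v) *\<^sub>R z"
proof (subst vector_eq_rdot[symmetric], intro allI)
  fix y
  have "J y (J z v) \<bullet> v = - ((v \<bullet> v) * (z \<bullet> y))"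
    using J_inner_J_right[of z v y] by (simp add: J_skew)
  then show "br (J z v) v \<bullet> y = (- (v \<bullet> v) *\<^sub>R z) \<bullet> y"
    by (simp add: br_inner)
qed

section \<open>The metric in a left-invariant orthonormal frame\<close>

abbreviation metric :: "('v \<times> 'z \<times> real) metric" where
  "metric \<equiv> dr_metric J"

text \<open>
  The components of a tangent vector at \<open>p\<close> in the left-invariant orthonormal frame, and the
  inverse of this linear isomorphism.
\<close>

definition coframe :: "'v \<times> 'z \<times> real \<Rightarrow> 'v \<times> 'z \<times> real \<Rightarrow> 'v \<times> 'z \<times> real" where
  "coframe = (\<lambda>(v, z, t) (x, y, s). (x /\<^sub>R sqrt t, (y + (1/2) *\<^sub>R br x v) /\<^sub>R t, s / t))"

definition frame :: "'v \<times> 'z \<times> real \<Rightarrow> 'v \<times> 'z \<times> real \<Rightarrow> 'v \<times> 'z \<times> real" where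
  "frame = (\<lambda>(v, z, t) (x, y, s).
     (sqrt t *\<^sub>R x, t *\<^sub>R y - (1/2) *\<^sub>R br (sqrt t *\<^sub>R x) v, t * s))"

lemma linear_coframe: "linear (coframe p)"
  by (intro linearI)
    (auto simp: coframe_def br.add_left br.scaleR_left algebra_simps add_divide_distrib split: prod.splits)

lemma linear_frame: "linear (frame p)"
  by (intro linearI)
    (auto simp: frame_def br.add_left br.scaleR_left algebra_simps split: prod.splits)

lemma frame_coframe: "p \<in> half_space \<Longrightarrow> frame p (coframe p X) = X"
  and coframe_frame: "p \<in> half_space \<Longrightarrow> coframe p (frame p X) = X"
  by (auto simp: frame_def coframe_def half_space_def split: prod.splits)

lemma metric_eq_inner: "p \<in> half_space \<Longrightarrow> metric p X Y = coframe p X \<bullet> coframe p Y"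
  by (auto simp: dr_metric_def coframe_def half_space_def divide_simps power2_eq_square
      ring_distribs mult.assoc simp del: inner_add_left inner_add_right split: prod.splits)

lemma metric_norm_eq: "p \<in> half_space \<Longrightarrow> metric_norm metric p X = norm (coframe p X)"
  by (simp add: metric_norm_def metric_eq_inner norm_eq_sqrt_inner)

lemma metric_Cauchy_Schwarz:
  "p \<in> half_space \<Longrightarrow> \<bar>metric p X Y\<bar> \<le> metric_norm metric p X * metric_norm metric p Y"
  by (simp add: metric_norm_eq metric_eq_inner Cauchy_Schwarz_ineq2)

lemma metric_commute: "metric p X Y = metric p Y X"
  by (auto simp: dr_metric_def inner_commute mult.commute split: prod.splits)

lemma linear_metric: "linear (metric p X)"
  by (intro linearI) (auto simp: dr_metric_def br.add_left br.scaleR_left inner_simps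
      algebra_simps add_divide_distrib split: prod.splits)

lemma metric_left_simps:
  "metric p (X + X') Y = metric p X Y + metric p X' Y"
  "metric p (r *\<^sub>R X) Y = r * metric p X Y"
  using linear_add[OF linear_metric, of p Y] linear_cmul[OF linear_metric, of p Y]
  by (simp_all add: metric_commute[of p _ Y])

text \<open>Nondegeneracy supplies the uniqueness behind the definite descriptions in
  \<open>gradient\<close> and \<open>christoffel\<close>.\<close>

lemma metric_eqI:
  assumes "p \<in> half_space" "\<And>X. metric p w X = metric p w' X"
  shows "w = w'"
proof -
  have "coframe p w \<bullet> u = coframe p w' \<bullet> u" for u
    using assms(2)[of "frame p u"] by (simp add: metric_eq_inner[OF assms(1)] coframe_frame[OF assms(1)])
  then show ?thesis
    by (metis frame_coframe[OF assms(1)] vector_eq_rdot)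
qed

lemma finite_dimensional_tangent: "finite_dimensional (UNIV :: ('v \<times> 'z \<times> real) set)"
proof -
  obtain A :: "'v set" where A: "finite A" "orthonormal A" "span A = UNIV"
    using orthonormal_basis_exists[OF finite_dimensional_v] .
  obtain B :: "'z set" where B: "finite B" "orthonormal B" "span B = UNIV"
    using orthonormal_basis_exists[OF finite_dimensional_z] .
  show ?thesis
    using prod_basis_orthonormal[OF A B] by (auto simp: finite_dimensional_def)
qed

lemma metric_Riesz:
  assumes p: "p \<in> half_space" and f: "linear f"
  shows "\<exists>w. \<forall>X. metric p w X = f X"
proof -
  have "linear (\<lambda>u. f (frame p u))"
    using linear_compose[OF linear_frame f] by (simp add: o_def)
  then obtain w where w: "\<forall>u. w \<bullet> u = f (frame p u)"
    using linear_functional_Riesz[OF finite_dimensional_tangent] by blast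
  have "metric p (frame p w) X = f X" for X
    by (simp only: metric_eq_inner[OF p] coframe_frame[OF p] w frame_coframe[OF p])
  then show ?thesis
    by blast
qed

text \<open>The derivative of the metric coefficients in the direction of the second argument, the
  two tangent vectors being held fixed. The component \<zeta> does not occur on the right since the
  coefficients do not depend on z.\<close>

definition metric_deriv :: "'v \<times> 'z \<times> real \<Rightarrow> 'v \<times> 'z \<times> real \<Rightarrow> 'v \<times> 'z \<times> real \<Rightarrow> 'v \<times> 'z \<times> real \<Rightarrow> real"
  where "metric_deriv = (\<lambda>(v, z, t) (\<xi>, \<zeta>, \<tau>) (y1, y2, y3) (z1, z2, z3).
     - (y1 \<bullet> z1) * \<tau> / t\<^sup>2
     + ((1/2) *\<^sub>R br y1 \<xi> \<bullet> (z2 + (1/2) *\<^sub>R br z1 v)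
        + (y2 + (1/2) *\<^sub>R br y1 v) \<bullet> (1/2) *\<^sub>R br z1 \<xi>) / t\<^sup>2
     - 2 * \<tau> / t ^ 3 * ((y2 + (1/2) *\<^sub>R br y1 v) \<bullet> (z2 + (1/2) *\<^sub>R br z1 v))
     - 2 * \<tau> / t ^ 3 * (y3 * z3))"

text \<open>The product rule with moving vector fields: constant fields give the terms of the Koszul
  formula, and Y = Z = N gives the derivative of the squared norm of the unit normal.\<close>

lemma metric_has_derivative:
  assumes p: "p \<in> half_space"
    and Y: "(Y has_derivative Y') (at p)" and Z: "(Z has_derivative Z') (at p)"
  shows "((\<lambda>q. metric q (Y q) (Z q)) has_derivative
    (\<lambda>X. metric_deriv p X (Y p) (Z p) + metric p (Y' X) (Z p) + metric p (Y p) (Z' X))) (at p)"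
proof -
  have t: "snd (snd p) > 0"
    using p by (auto simp: half_space_def)
  have eq: "metric = (\<lambda>q Y Z. (fst Y \<bullet> fst Z) / snd (snd q)
     + ((fst (snd Y) + (1/2) *\<^sub>R br (fst Y) (fst q)) \<bullet> (fst (snd Z) + (1/2) *\<^sub>R br (fst Z) (fst q))) / (snd (snd q))\<^sup>2
     + snd (snd Y) * snd (snd Z) / (snd (snd q))\<^sup>2)"
    by (auto simp: dr_metric_def fun_eq_iff)
  have eqd: "metric_deriv = (\<lambda>q X Y Z.
     - (fst Y \<bullet> fst Z) * snd (snd X) / (snd (snd q))\<^sup>2
     + ((1/2) *\<^sub>R br (fst Y) (fst X) \<bullet> (fst (snd Z) + (1/2) *\<^sub>R br (fst Z) (fst q))
        + (fst (snd Y) + (1/2) *\<^sub>R br (fst Y) (fst q)) \<bullet> (1/2) *\<^sub>R br (fst Z) (fst X)) / (snd (snd q))\<^sup>2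
     - 2 * snd (snd X) / snd (snd q) ^ 3
        * ((fst (snd Y) + (1/2) *\<^sub>R br (fst Y) (fst q)) \<bullet> (fst (snd Z) + (1/2) *\<^sub>R br (fst Z) (fst q)))
     - 2 * snd (snd X) / snd (snd q) ^ 3 * (snd (snd Y) * snd (snd Z)))"
    by (auto simp: metric_deriv_def fun_eq_iff)
  note Y[derivative_intros] Z[derivative_intros] br.FDERIV[derivative_intros]
  show ?thesis
    unfolding eq eqd
    apply (rule derivative_eq_intros refl | (use t in \<open>simp; fail\<close>))+
    apply (rule ext)
    using t
    apply (simp add: inner_simps inner_commute br.add_left br.add_right power2_eq_square power3_eq_cube divide_simps)
    apply (simp add: algebra_simps)
    done
qed

lemma metric_const_has_derivative:
  assumes "p \<in> half_space"
  shows "((\<lambda>q. metric q Y Z) has_derivative (\<lambda>X. metric_deriv p X Y Z)) (at p)"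
  using metric_has_derivative[OF assms has_derivative_const has_derivative_const, of Y Z]
  by (simp add: metric_commute[of p 0] linear_0[OF linear_metric])

lemma linear_metric_deriv:
  assumes "p \<in> half_space"
  shows "linear (\<lambda>X. metric_deriv p X Y Z)" "linear (metric_deriv p X Y)"
proof -
  show "linear (\<lambda>X. metric_deriv p X Y Z)"
    using has_derivative_linear[OF metric_const_has_derivative[OF assms]] .
  show "linear (metric_deriv p X Y)"
    by (intro linearI) (auto simp: metric_deriv_def br.add_left br.scaleR_left
      algebra_simps add_divide_distrib diff_divide_distrib split: prod.splits)
qed

lemma christoffel_Koszul:
  assumes p: "p \<in> half_space"
  shows "2 * metric p (christoffel metric p X Y) Z
    = metric_deriv p X Y Z + metric_deriv p Y X Z - metric_deriv p Z X Y"
proof -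
  have fd: "frechet_derivative (\<lambda>q. metric q Y Z) (at p) = (\<lambda>X. metric_deriv p X Y Z)" for Y Z
    using frechet_derivative_at[OF metric_const_has_derivative[OF p]] by simp
  have "linear (\<lambda>Z. (metric_deriv p X Y Z + metric_deriv p Y X Z - metric_deriv p Z X Y) / 2)"
    by (intro linearI) (simp_all add: linear_add[OF linear_metric_deriv(1)[OF p]]
        linear_add[OF linear_metric_deriv(2)[OF p]] linear_cmul[OF linear_metric_deriv(1)[OF p]]
        linear_cmul[OF linear_metric_deriv(2)[OF p]] algebra_simps add_divide_distrib diff_divide_distrib)
  then obtain w where w: "\<forall>Z. metric p w Z
      = (metric_deriv p X Y Z + metric_deriv p Y X Z - metric_deriv p Z X Y) / 2"
    using metric_Riesz[OF p] by blast
  then have w2: "\<forall>Z. 2 * metric p w Z = metric_deriv p X Y Z + metric_deriv p Y X Z - metric_deriv p Z X Y"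
    by (simp only: w) simp
  have "\<forall>Z. 2 * metric p (christoffel metric p X Y) Z
    = metric_deriv p X Y Z + metric_deriv p Y X Z - metric_deriv p Z X Y"
    unfolding christoffel_def fd using w2
  proof (rule theI)
    fix w'
    assume "\<forall>Z. 2 * metric p w' Z = metric_deriv p X Y Z + metric_deriv p Y X Z - metric_deriv p Z X Y"
    with w2 have "\<And>Z. 2 * metric p w' Z = 2 * metric p w Z"
      by metis
    then have "\<And>Z. metric p w' Z = metric p w Z"
      by simp
    then show "w' = w"
      by (rule metric_eqI[OF p])
  qed
  then show ?thesis ..
qed

lemma metric_deriv_commute: "metric_deriv p X Y Z = metric_deriv p X Z Y"
  by (auto simp: metric_deriv_def inner_commute mult.commute split: prod.splits)

text \<open>For Z = X the first and third Koszul terms cancel by symmetry of the metric. This gives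
  the diagonal entries of the endomorphism sending X to
  \<open>christoffel metric p X Y\<close>.\<close>

lemma metric_christoffel_left:
  "p \<in> half_space \<Longrightarrow> metric p (christoffel metric p X Y) X = metric_deriv p Y X X / 2"
  using christoffel_Koszul[of p X Y X] metric_deriv_commute[of p X X Y] by simp

text \<open>For Z = Y the second and third Koszul terms cancel. This is metric compatibility in the
  form needed to differentiate a squared length.\<close>

lemma metric_christoffel_right:
  "p \<in> half_space \<Longrightarrow> metric p (christoffel metric p X Y) Y = metric_deriv p X Y Y / 2"
  using christoffel_Koszul[of p X Y Y] by simp

lemma linear_christoffel:
  assumes p: "p \<in> half_space"
  shows "linear (\<lambda>X. christoffel metric p X Y)"
proof -
  have swap: "metric_deriv p Z X Y = metric_deriv p Z Y X" for X Z
    by (rule metric_deriv_commute)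
  have lin: "linear (\<lambda>X. metric_deriv p X Y Z + metric_deriv p Y X Z - metric_deriv p Z X Y)" for Z
    unfolding swap[of Z] metric_deriv_commute[of p Y _ Z] using linear_metric_deriv[OF p]
    by (intro linear_compose_add linear_compose_sub)
  show ?thesis
  proof (rule linearI)
    fix X X' r
    have "2 * metric p (christoffel metric p (X + X') Y) Z
        = 2 * metric p (christoffel metric p X Y + christoffel metric p X' Y) Z" for Z
      using linear_add[OF lin[of Z], of X X']
      by (simp add: christoffel_Koszul[OF p] metric_left_simps distrib_left)
    then show "christoffel metric p (X + X') Y = christoffel metric p X Y + christoffel metric p X' Y"
      by (intro metric_eqI[OF p]) simp
    have "2 * metric p (christoffel metric p (r *\<^sub>R X) Y) Z
        = r * (2 * metric p (christoffel metric p X Y) Z)" for Z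
      unfolding christoffel_Koszul[OF p] using linear_cmul[OF lin[of Z], of r X] by simp
    then show "christoffel metric p (r *\<^sub>R X) Y = r *\<^sub>R christoffel metric p X Y"
      by (intro metric_eqI[OF p]) (simp add: metric_left_simps)
  qed
qed

text \<open>By the Koszul formula this trace is the logarithmic derivative of the Riemannian density.\<close>

lemma trace_christoffel:
  assumes p: "p = (v, z, t)" and t: "t > 0" and Y: "Y = (\<xi>, \<zeta>, \<tau>)"
  shows "trace_on UNIV (\<lambda>X. christoffel metric p X Y)
    = - (real (dim (UNIV :: 'v set)) / 2 + real (dim (UNIV :: 'z set)) + 1) * \<tau> / t"
proof -
  have ph: "p \<in> half_space"
    using t by (simp add: p half_space_def)
  obtain A :: "'v set" where A: "finite A" "orthonormal A" "span A = UNIV"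
    using orthonormal_basis_exists[OF finite_dimensional_v] .
  obtain B :: "'z set" where B: "finite B" "orthonormal B" "span B = UNIV"
    using orthonormal_basis_exists[OF finite_dimensional_z] .
  note AB = prod_basis_orthonormal[OF A B]
  \<comment> \<open>The z-entry of \<open>frame p (a, 0, 0)\<close> is chosen so that its
    z-component in the coframe is 0. The terms involving brackets therefore vanish and only the
    coefficient 1/t contributes, whereas the z and t directions carry 1/t^2 and give twice as
    much.\<close>
  have a: "metric_deriv p Y (frame p (a, 0, 0)) (frame p (a, 0, 0)) = - \<tau> / t" if "a \<in> A" for a
    using that A(2) t by (simp add: p Y frame_def metric_deriv_def orthonormal_def power2_eq_square)
  have b: "metric_deriv p Y (frame p (0, b, 0)) (frame p (0, b, 0)) = - 2 * \<tau> / t" if "b \<in> B" for b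
    using that B(2) t
    by (simp add: p Y frame_def metric_deriv_def orthonormal_def br.zero_left power3_eq_cube)
  have c: "metric_deriv p Y (frame p (0, 0, 1)) (frame p (0, 0, 1)) = - 2 * \<tau> / t"
    using t by (simp add: p Y frame_def metric_deriv_def br.zero_left power3_eq_cube)
  have "trace_on UNIV (\<lambda>X. christoffel metric p X Y)
      = (\<Sum>u\<in>prod_basis A B. coframe p (christoffel metric p (frame p u) Y) \<bullet> u)"
    by (rule trace_on_UNIV_orthonormal[OF AB(1-3) linear_coframe linear_frame])
      (simp_all add: coframe_frame frame_coframe ph linear_christoffel)
  also have "\<dots> = (\<Sum>u\<in>prod_basis A B.
      metric p (christoffel metric p (frame p u) Y) (frame p u))"
    by (simp only: metric_eq_inner[OF ph] coframe_frame[OF ph])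
  also have "\<dots> = (\<Sum>u\<in>prod_basis A B. metric_deriv p Y (frame p u) (frame p u) / 2)"
    by (simp only: metric_christoffel_left[OF ph])
  also have "\<dots> = (\<Sum>a\<in>A. - \<tau> / t / 2) + (\<Sum>b\<in>B. - 2 * \<tau> / t / 2) + - 2 * \<tau> / t / 2"
    by (simp only: AB(4) a b c cong: sum.cong)
  also have "\<dots> = - (real (card A) / 2 + real (card B) + 1) * \<tau> / t"
    using t by (simp add: field_simps)
  also have "card A = dim (UNIV :: 'v set)"
    using orthonormal_card[OF A(1,2)] A(3) by simp
  also have "card B = dim (UNIV :: 'z set)"
    using orthonormal_card[OF B(1,2)] B(3) by simp
  finally show ?thesis .
qed

end

subsection \<open>The isoparametric function and its gradient\<close>

lemma orth_proj_eqI: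
  assumes W: "subspace W" "x \<in> W" and orth: "\<And>w. w \<in> W \<Longrightarrow> orthogonal (v - x) w"
  shows "orth_proj W v = x"
  unfolding orth_proj_def
proof (rule the_equality)
  fix x' assume x': "x' \<in> W \<and> (\<forall>w\<in>W. orthogonal (v - x') w)"
  then have "x - x' \<in> W"
    using W by (simp add: subspace_diff)
  then have "(v - x') \<bullet> (x - x') = 0" "(v - x) \<bullet> (x - x') = 0"
    using x' orth by (auto simp: orthogonal_def)
  then have "(x - x') \<bullet> (x - x') = 0"
    by (simp add: inner_diff_left)
  then show "x' = x"
    by simp
qed (use W orth in auto)

section \<open>The splitting of v and its involution\<close>

locale isoparametric = damek_ricci J for J :: "'z::real_inner \<Rightarrow> 'v::real_inner \<Rightarrow> 'v" +
  fixes Vp Vm :: "'v set" and v0 :: 'v and z0 :: 'z and lam :: real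
  assumes submod_p: "clifford_submodule J Vp"
    and submod_m: "clifford_submodule J Vm"
    and decomp: "orthogonal_decomposition Vp Vm"
    and lam: "lam > 0"
begin

text \<open>The orthogonal reflection that is 1 on \<open>Vp\<close> and -1 on \<open>Vm\<close>; it
  is both symmetric and isometric.\<close>

definition sig :: "'v \<Rightarrow> 'v" where
  "sig v = orth_proj Vp v - orth_proj Vm v"

lemma sig_decomp:
  assumes "x \<in> Vp" "y \<in> Vm"
  shows "sig (x + y) = x - y"
proof -
  have "orth_proj Vp (x + y) = x"
    using assms submod_p decomp
    by (intro orth_proj_eqI)
      (auto simp: clifford_submodule_def orthogonal_decomposition_def orthogonal_commute)
  moreover have "orth_proj Vm (x + y) = y"
    using assms submod_m decomp
    by (intro orth_proj_eqI) (auto simp: clifford_submodule_def orthogonal_decomposition_def)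
  ultimately show ?thesis
    by (simp add: sig_def)
qed

lemma decompE:
  obtains x y where "x \<in> Vp" "y \<in> Vm" "v = x + y"
  using decomp unfolding orthogonal_decomposition_def by blast

lemma decomp_orthogonal: "x \<in> Vp \<Longrightarrow> y \<in> Vm \<Longrightarrow> x \<bullet> y = 0"
  using decomp by (auto simp: orthogonal_decomposition_def orthogonal_def)

lemma subspace_p: "subspace Vp" and subspace_m: "subspace Vm"
  using submod_p submod_m by (auto simp: clifford_submodule_def)

lemma sig_p: "x \<in> Vp \<Longrightarrow> sig x = x" and sig_m: "y \<in> Vm \<Longrightarrow> sig y = - y"
  using sig_decomp[of x 0] sig_decomp[of 0 y] subspace_p subspace_m
  by (auto simp: subspace_0)

lemma sig_inner_sig: "sig u \<bullet> sig w = u \<bullet> w"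
proof -
  obtain x y x' y' where "x \<in> Vp" "y \<in> Vm" "u = x + y" "x' \<in> Vp" "y' \<in> Vm" "w = x' + y'"
    by (metis decompE)
  then show ?thesis
    using decomp_orthogonal[of x y'] decomp_orthogonal[of x' y]
    by (simp add: sig_decomp inner_simps inner_commute)
qed

lemma sig_inner: "sig u \<bullet> w = u \<bullet> sig w"
proof -
  obtain x y x' y' where "x \<in> Vp" "y \<in> Vm" "u = x + y" "x' \<in> Vp" "y' \<in> Vm" "w = x' + y'"
    by (metis decompE)
  then show ?thesis
    using decomp_orthogonal[of x y'] decomp_orthogonal[of x' y]
    by (simp add: sig_decomp inner_simps inner_commute)
qed

text \<open>Both summands are stable under \<open>J z\<close>, so applying \<open>J z\<close> to a
  decomposition of v yields the decomposition of \<open>J z v\<close>.\<close>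

lemma J_sig: "sig (J z v) = J z (sig v)"
proof -
  obtain x y where "x \<in> Vp" "y \<in> Vm" "v = x + y"
    by (metis decompE)
  then show ?thesis
    using submod_p submod_m
    by (simp add: sig_decomp J.add_right J.diff_right clifford_submodule_def)
qed

text \<open>The composition of the symmetric \<open>sig\<close> with the skew \<open>J z\<close> is
  skew because the two commute, so its quadratic form vanishes.\<close>

lemma sig_J_inner: "sig v \<bullet> J z v = 0"
  using J_skew[of z v "sig v"] sig_inner[of v "J z v"] by (simp add: J_sig inner_commute)

lemma br_sig: "br (sig v) v = 0"
  using sig_J_inner
  by (subst vector_eq_rdot[symmetric]) (simp add: br_inner J_skew)

sublocale sig: bounded_linear sig
proof
  show "sig (u + w) = sig u + sig w" for u w
  proof -
    obtain x y x' y' where "x \<in> Vp" "y \<in> Vm" "u = x + y" "x' \<in> Vp" "y' \<in> Vm" "w = x' + y'"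
      by (metis decompE)
    then show ?thesis
      using sig_decomp[of "x + x'" "y + y'"] subspace_p subspace_m
      by (simp add: sig_decomp subspace_add algebra_simps)
  qed
  show "sig (r *\<^sub>R u) = r *\<^sub>R sig u" for r u
  proof -
    obtain x y where "x \<in> Vp" "y \<in> Vm" "u = x + y"
      by (metis decompE)
    then show ?thesis
      using sig_decomp[of "r *\<^sub>R x" "r *\<^sub>R y"] subspace_p subspace_m
      by (simp add: sig_decomp subspace_scale algebra_simps)
  qed
  show "\<exists>K. \<forall>x. norm (sig x) \<le> norm x * K"
    by (intro exI[of _ 1]) (simp add: norm_eq_sqrt_inner sig_inner_sig)
qed

text \<open>
  Left translation by \<open>(v0, z0, 1)\<close> is an isometry with linear part \<open>frame (v0, z0, 1)\<close>;
  \<open>shift\<close> is its inverse and reduces everything to \<open>v0 = 0\<close>, \<open>z0 = 0\<close>.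
\<close>

definition shift :: "'v \<times> 'z \<times> real \<Rightarrow> 'v \<times> 'z \<times> real" where
  "shift p = coframe (v0, z0, 1) (p - (v0, z0, 0))"

lemma coframe_base: "coframe (v0, z0, 1) (x, y, s) = (x, y + (1/2) *\<^sub>R br x v0, s)"
  and frame_base: "frame (v0, z0, 1) (x, y, s) = (x, y - (1/2) *\<^sub>R br x v0, s)"
  by (simp_all add: coframe_def frame_def)

lemma shift_eq: "shift (v, z, t) = (v - v0, z - z0 + (1/2) *\<^sub>R br v v0, t)"
  by (simp add: shift_def coframe_base br.diff_left br_self)

section \<open>F and its gradient in translated coordinates\<close>

definition height :: "'v \<times> 'z \<times> real \<Rightarrow> real" where
  "height = (\<lambda>(w, \<zeta>, t). t + (w \<bullet> w) / 4)"

definition numer :: "'v \<times> 'z \<times> real \<Rightarrow> real" where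
  "numer = (\<lambda>(w, \<zeta>, t). (height (w, \<zeta>, t))\<^sup>2 + \<zeta> \<bullet> \<zeta> + lam * (w \<bullet> sig w) + 4 * lam\<^sup>2)"

definition F :: "'v \<times> 'z \<times> real \<Rightarrow> real" where
  "F = isoparam_fun J Vp Vm v0 z0 lam"

lemma F_eq: "F p = numer (shift p) / snd (snd p)"
  by (cases p) (simp add: F_def isoparam_fun_def shift_eq numer_def height_def
      flip: sig_def power2_norm_eq_inner, simp add: power_divide)

definition numer_deriv :: "'v \<times> 'z \<times> real \<Rightarrow> 'v \<times> 'z \<times> real \<Rightarrow> real" where
  "numer_deriv = (\<lambda>(w, \<zeta>, t) (x, y, s).
     2 * height (w, \<zeta>, t) * (s + (w \<bullet> x) / 2) + 2 * (\<zeta> \<bullet> y) + 2 * lam * (sig w \<bullet> x))"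

text \<open>Raising the index of dF at v0 = 0, z0 = 0 gives the z-component 2 t \<zeta> minus half
  the bracket of the first component with w. That bracket is - |w|^2 \<zeta>, since
  \<open>br_self\<close> and \<open>br_sig\<close> kill the other two terms, and 2 t + |w|^2 / 2 is
  twice the height.\<close>

definition grad_base :: "'v \<times> 'z \<times> real \<Rightarrow> 'v \<times> 'z \<times> real" where
  "grad_base = (\<lambda>(w, \<zeta>, t).
     (height (w, \<zeta>, t) *\<^sub>R w + J \<zeta> w + (2 * lam) *\<^sub>R sig w, (2 * height (w, \<zeta>, t)) *\<^sub>R \<zeta>,
      2 * t * height (w, \<zeta>, t) - numer (w, \<zeta>, t)))"

definition grad_base_deriv :: "'v \<times> 'z \<times> real \<Rightarrow> 'v \<times> 'z \<times> real \<Rightarrow> 'v \<times> 'z \<times> real" where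
  "grad_base_deriv = (\<lambda>(w, \<zeta>, t) (x, y, s).
     ((s + (w \<bullet> x) / 2) *\<^sub>R w + height (w, \<zeta>, t) *\<^sub>R x + J \<zeta> x + J y w + (2 * lam) *\<^sub>R sig x,
      (2 * (s + (w \<bullet> x) / 2)) *\<^sub>R \<zeta> + (2 * height (w, \<zeta>, t)) *\<^sub>R y,
      2 * s * height (w, \<zeta>, t) + 2 * t * (s + (w \<bullet> x) / 2) - numer_deriv (w, \<zeta>, t) (x, y, s)))"

lemma height_has_derivative:
  "(height has_derivative (\<lambda>X. snd (snd X) + (fst q \<bullet> fst X) / 2)) (at q)"
proof -
  have eq: "height = (\<lambda>q. snd (snd q) + (fst q \<bullet> fst q) / 4)"
    by (auto simp: height_def fun_eq_iff)
  show ?thesis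
    unfolding eq by (auto intro!: derivative_eq_intros simp: inner_commute)
qed

lemma numer_has_derivative: "(numer has_derivative numer_deriv q) (at q)"
proof -
  have eq: "numer = (\<lambda>q. (height q)\<^sup>2 + fst (snd q) \<bullet> fst (snd q) + lam * (fst q \<bullet> sig (fst q)) + 4 * lam\<^sup>2)"
    by (auto simp: numer_def fun_eq_iff)
  have eqd: "numer_deriv q = (\<lambda>X. 2 * height q * (snd (snd X) + (fst q \<bullet> fst X) / 2)
      + 2 * (fst (snd q) \<bullet> fst (snd X)) + 2 * lam * (sig (fst q) \<bullet> fst X))"
    by (cases q) (auto simp: numer_deriv_def fun_eq_iff)
  have sym: "fst q \<bullet> sig x = x \<bullet> sig (fst q)" for x
    using sig_inner[of "fst q" x] by (simp add: inner_commute)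
  note height_has_derivative[derivative_intros] sig.has_derivative[derivative_intros]
  show ?thesis
    unfolding eq eqd
    by (auto intro!: derivative_eq_intros simp: sym inner_commute algebra_simps)
qed

lemma grad_base_has_derivative: "(grad_base has_derivative grad_base_deriv q) (at q)"
proof -
  have eq: "grad_base = (\<lambda>q. (height q *\<^sub>R fst q + J (fst (snd q)) (fst q) + (2 * lam) *\<^sub>R sig (fst q),
     (2 * height q) *\<^sub>R fst (snd q), 2 * snd (snd q) * height q - numer q))"
    by (auto simp: grad_base_def fun_eq_iff)
  have eqd: "grad_base_deriv q = (\<lambda>X.
     ((snd (snd X) + (fst q \<bullet> fst X) / 2) *\<^sub>R fst q + height q *\<^sub>R fst X + J (fst (snd q)) (fst X)
       + J (fst (snd X)) (fst q) + (2 * lam) *\<^sub>R sig (fst X),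
      (2 * (snd (snd X) + (fst q \<bullet> fst X) / 2)) *\<^sub>R fst (snd q) + (2 * height q) *\<^sub>R fst (snd X),
      2 * snd (snd X) * height q + 2 * snd (snd q) * (snd (snd X) + (fst q \<bullet> fst X) / 2) - numer_deriv q X))"
    by (cases q) (auto simp: grad_base_deriv_def fun_eq_iff)
  note height_has_derivative[derivative_intros] numer_has_derivative[derivative_intros]
    sig.has_derivative[derivative_intros] J.FDERIV[derivative_intros]
  show ?thesis
    unfolding eq eqd
    by (auto intro!: derivative_eq_intros simp: algebra_simps)
qed

lemma bounded_linear_coframe_base: "bounded_linear (coframe (v0, z0, 1))"
proof -
  have eq: "coframe (v0, z0, 1) = (\<lambda>X. (fst X, fst (snd X) + (1/2) *\<^sub>R br (fst X) v0, snd (snd X)))"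
    by (auto simp: coframe_base fun_eq_iff)
  show ?thesis
    unfolding eq by (intro bounded_linear_intros br.bounded_linear_left
        bounded_linear_compose[OF br.bounded_linear_left])
qed

lemma bounded_linear_frame_base: "bounded_linear (frame (v0, z0, 1))"
proof -
  have eq: "frame (v0, z0, 1) = (\<lambda>X. (fst X, fst (snd X) - (1/2) *\<^sub>R br (fst X) v0, snd (snd X)))"
    by (auto simp: frame_base fun_eq_iff)
  show ?thesis
    unfolding eq by (intro bounded_linear_intros br.bounded_linear_left
        bounded_linear_compose[OF br.bounded_linear_left])
qed

lemma shift_has_derivative: "(shift has_derivative coframe (v0, z0, 1)) (at p)"
proof -
  have "((\<lambda>p. p - (v0, z0, 0)) has_derivative (\<lambda>X. X)) (at p)"
    by (auto intro!: derivative_eq_intros)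
  from bounded_linear.has_derivative[OF bounded_linear_coframe_base this] show ?thesis
    by (simp add: shift_def[abs_def])
qed

definition F_deriv :: "'v \<times> 'z \<times> real \<Rightarrow> 'v \<times> 'z \<times> real \<Rightarrow> real" where
  "F_deriv p X = (numer_deriv (shift p) (coframe (v0, z0, 1) X) - F p * snd (snd X)) / snd (snd p)"

lemma F_has_derivative:
  assumes "p \<in> half_space"
  shows "(F has_derivative F_deriv p) (at p)"
proof -
  have t: "snd (snd p) > 0"
    using assms by (auto simp: half_space_def)
  have "((\<lambda>p. numer (shift p)) has_derivative (\<lambda>X. numer_deriv (shift p) (coframe (v0, z0, 1) X))) (at p)"
    using has_derivative_compose[OF shift_has_derivative numer_has_derivative] .
  note this[derivative_intros]
  show ?thesis
    unfolding F_eq[abs_def] F_deriv_def[abs_def]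
    by (rule derivative_eq_intros refl | (use t in \<open>simp; fail\<close>))+
      (use t in \<open>simp add: fun_eq_iff divide_simps power2_eq_square\<close>)
qed

definition grad :: "'v \<times> 'z \<times> real \<Rightarrow> 'v \<times> 'z \<times> real" where
  "grad p = frame (v0, z0, 1) (grad_base (shift p))"

definition grad_deriv :: "'v \<times> 'z \<times> real \<Rightarrow> 'v \<times> 'z \<times> real \<Rightarrow> 'v \<times> 'z \<times> real" where
  "grad_deriv p X = frame (v0, z0, 1) (grad_base_deriv (shift p) (coframe (v0, z0, 1) X))"

lemma grad_has_derivative: "(grad has_derivative grad_deriv p) (at p)"
  unfolding grad_def[abs_def] grad_deriv_def[abs_def]
  by (intro bounded_linear.has_derivative[OF bounded_linear_frame_base]
      has_derivative_compose[OF shift_has_derivative grad_base_has_derivative])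

text \<open>The coframe undoes the step from 2 t \<zeta> to the coordinate component: its z-part
  restores (2 t) \<zeta>, which cancels one power of t in the metric. The term
  \<open>J \<zeta> w\<close> of the gradient then compensates the bracket of x with w.\<close>

lemma metric_grad:
  assumes p: "p \<in> half_space"
  shows "metric p (grad p) X = F_deriv p X"
proof -
  obtain v z t where pe: "p = (v, z, t)" and t: "t > 0"
    using p by (auto simp: half_space_def)
  obtain x y s where X: "X = (x, y, s)"
    by (cases X)
  define w \<zeta> where "w = v - v0" and "\<zeta> = z - z0 + (1/2) *\<^sub>R br v v0"
  define A P where "A = height (w, \<zeta>, t)" and "P = numer (w, \<zeta>, t)"
  define a where "a = A *\<^sub>R w + J \<zeta> w + (2 * lam) *\<^sub>R sig w"
  have sh: "shift p = (w, \<zeta>, t)"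
    by (simp add: pe shift_eq w_def \<zeta>_def)
  have v: "v = w + v0"
    by (simp add: w_def)
  have gr: "grad p = (a, (2 * A) *\<^sub>R \<zeta> - (1/2) *\<^sub>R br a v0, 2 * t * A - P)"
    by (simp add: grad_def sh grad_base_def frame_base a_def A_def P_def)
  have "br a w = - (w \<bullet> w) *\<^sub>R \<zeta>"
    by (simp add: a_def br.add_left br.scaleR_left br_self br_sig br_J)
  then have "(2 * A) *\<^sub>R \<zeta> - (1/2) *\<^sub>R br a v0 + (1/2) *\<^sub>R br a v = (2 * A - (w \<bullet> w) / 2) *\<^sub>R \<zeta>"
    by (simp add: v br.add_right algebra_simps)
  also have "2 * A - (w \<bullet> w) / 2 = 2 * t"
    by (simp add: A_def height_def)
  finally have 1: "(2 * A) *\<^sub>R \<zeta> - (1/2) *\<^sub>R br a v0 + (1/2) *\<^sub>R br a v = (2 * t) *\<^sub>R \<zeta>" .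
  have 2: "\<zeta> \<bullet> br x v = \<zeta> \<bullet> br x v0 - x \<bullet> J \<zeta> w"
    using br_inner[of x w \<zeta>] J_skew[of \<zeta> x w] by (simp add: v br.add_right inner_simps inner_commute)
  have "metric p (grad p) X = (a \<bullet> x) / t + ((2 * t) *\<^sub>R \<zeta> \<bullet> (y + (1/2) *\<^sub>R br x v)) / t\<^sup>2
      + (2 * t * A - P) * s / t\<^sup>2"
    unfolding gr unfolding pe X dr_metric_def using 1 by simp
  also have "\<dots> = (a \<bullet> x + 2 * (\<zeta> \<bullet> y) + (\<zeta> \<bullet> br x v)) / t + (2 * t * A - P) * s / t\<^sup>2"
    using t by (simp add: inner_simps power2_eq_square divide_simps) (simp add: algebra_simps)
  also have "\<dots> = F_deriv p X"
    using t unfolding 2 F_deriv_def F_eq sh X coframe_base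
    by (simp add: numer_deriv_def pe a_def inner_simps power2_eq_square divide_simps
        flip: A_def P_def) (simp add: inner_commute algebra_simps)
  finally show ?thesis .
qed

lemma metric_grad_grad:
  assumes p: "p \<in> half_space"
  shows "metric p (grad p) (grad p) = (F p)\<^sup>2 - 16 * lam\<^sup>2"
proof -
  obtain v z t where pe: "p = (v, z, t)" and t: "t > 0"
    using p by (auto simp: half_space_def)
  define w \<zeta> where "w = v - v0" and "\<zeta> = z - z0 + (1/2) *\<^sub>R br v v0"
  define A P where "A = height (w, \<zeta>, t)" and "P = numer (w, \<zeta>, t)"
  define a where "a = A *\<^sub>R w + J \<zeta> w + (2 * lam) *\<^sub>R sig w"
  define c d e where "c = w \<bullet> w" and "d = w \<bullet> sig w" and "e = \<zeta> \<bullet> \<zeta>"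
  have sh: "shift p = (w, \<zeta>, t)"
    by (simp add: pe shift_eq w_def \<zeta>_def)
  have wa: "w \<bullet> a = A * c + 2 * lam * d"
    using J_self[of \<zeta> w] by (simp add: a_def inner_simps inner_commute c_def d_def)
  have sa: "sig w \<bullet> a = A * d + 2 * lam * c"
    using sig_J_inner[of w \<zeta>] sig_inner_sig[of w w]
    by (simp add: a_def inner_simps inner_commute c_def d_def)
  have gr: "coframe (v0, z0, 1) (grad p) = (a, (2 * A) *\<^sub>R \<zeta>, 2 * t * A - P)"
    by (simp add: grad_def sh grad_base_def frame_base coframe_base a_def A_def P_def)
  have gr3: "snd (snd (grad p)) = 2 * t * A - P"
    by (simp add: grad_def sh grad_base_def frame_base A_def P_def)
  have A: "A = t + c / 4" and P: "P = A\<^sup>2 + e + lam * d + 4 * lam\<^sup>2"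
    by (simp_all add: A_def P_def c_def d_def e_def height_def numer_def)
  have "metric p (grad p) (grad p)
      = (2 * A * ((2 * t * A - P) + (A * c + 2 * lam * d) / 2) + 2 * (2 * A * e)
         + 2 * lam * (A * d + 2 * lam * c) - P / t * (2 * t * A - P)) / t"
    unfolding metric_grad[OF p] F_deriv_def F_eq sh gr gr3
    by (simp add: numer_deriv_def pe wa sa flip: A_def P_def e_def)
  also have "\<dots> = (P / t)\<^sup>2 - 16 * lam\<^sup>2"
  proof -
    \<comment> \<open>Eliminating |w|^2 and |\<zeta>|^2 leaves a rational identity in A, P, d, t and
      lam; A and d then cancel altogether.\<close>
    have c: "c = 4 * (A - t)" and e: "e = P - A\<^sup>2 - lam * d - 4 * lam\<^sup>2"
      using A P by simp_all
    show ?thesis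
      unfolding c e using t by (simp add: field_simps power2_eq_square)
  qed
  finally show ?thesis
    by (simp add: F_eq sh[unfolded pe] pe P_def)
qed

text \<open>Completing the square writes t (F - 4 lam) as (height - 2 lam)^2 + lam (|w|^2 + w . sig
  w) + |\<zeta>|^2. The middle term is nonnegative because \<open>sig\<close> is an
  isometry.\<close>

lemma F_ge:
  assumes p: "p \<in> half_space"
  shows "F p \<ge> 4 * lam"
proof -
  obtain v z t where pe: "p = (v, z, t)" and t: "t > 0"
    using p by (auto simp: half_space_def)
  define w \<zeta> where "w = v - v0" and "\<zeta> = z - z0 + (1/2) *\<^sub>R br v v0"
  have sh: "shift p = (w, \<zeta>, t)"
    by (simp add: pe shift_eq w_def \<zeta>_def)
  have "- (w \<bullet> sig w) \<le> w \<bullet> w"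
    using norm_cauchy_schwarz[of w "- sig w"] sig_inner_sig[of w w]
    by (simp add: norm_eq_sqrt_inner)
  then have "0 \<le> (height (w, \<zeta>, t) - 2 * lam)\<^sup>2 + lam * (w \<bullet> w + w \<bullet> sig w) + \<zeta> \<bullet> \<zeta>"
    using lam by simp
  also have "\<dots> = numer (w, \<zeta>, t) - 4 * lam * t"
    by (simp add: numer_def height_def power2_eq_square field_simps)
  finally show ?thesis
    using t by (simp add: F_eq sh[unfolded pe] pe divide_simps)
qed

end

subsection \<open>The distance to the focal variety\<close>

lemma convex_half_space:
  "convex (half_space :: ('a::real_normed_vector \<times> 'b::real_normed_vector \<times> real) set)"
proof -
  have "half_space = (UNIV :: 'a set) \<times> (UNIV :: 'b set) \<times> {0::real<..}"
    by (auto simp: half_space_def)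
  also have "convex \<dots>"
    by (intro convex_Times convex_UNIV convex_real_interval)
  finally show ?thesis .
qed

section \<open>Critical points and the lower bound for lengths\<close>

context isoparametric
begin

lemma frechet_derivative_F: "p \<in> half_space \<Longrightarrow> frechet_derivative F (at p) = F_deriv p"
  using frechet_derivative_at[OF F_has_derivative] by simp

lemma linear_F_deriv: "p \<in> half_space \<Longrightarrow> linear (F_deriv p)"
  using has_derivative_linear[OF F_has_derivative] .

lemma gradient_F:
  assumes p: "p \<in> half_space"
  shows "gradient metric F p = grad p"
  unfolding gradient_def frechet_derivative_F[OF p] using metric_grad[OF p]
  by (intro the_equality allI metric_eqI[OF p]) auto

lemma metric_norm_grad:
  "p \<in> half_space \<Longrightarrow> metric_norm metric p (grad p) = sqrt ((F p)\<^sup>2 - 16 * lam\<^sup>2)"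
  by (simp add: metric_norm_def metric_grad_grad)

lemma F_deriv_le:
  assumes p: "p \<in> half_space"
  shows "\<bar>F_deriv p X\<bar> \<le> sqrt ((F p)\<^sup>2 - 16 * lam\<^sup>2) * metric_norm metric p X"
  using metric_Cauchy_Schwarz[OF p, of "grad p" X] by (simp add: metric_grad metric_norm_grad p)

text \<open>At a critical point |grad F|^2 = 0 forces F = 4 lam by positivity of F; conversely, at
  this value the Cauchy-Schwarz bound on dF is 0.\<close>

lemma critical_point_iff:
  assumes p: "p \<in> half_space"
  shows "critical_point F p \<longleftrightarrow> F p = 4 * lam"
proof
  assume "critical_point F p"
  then have "F_deriv p (grad p) = 0"
    unfolding critical_point_def frechet_derivative_F[OF p] by blast
  then have "(F p)\<^sup>2 = (4 * lam)\<^sup>2"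
    using metric_grad_grad[OF p] by (simp add: metric_grad p)
  then show "F p = 4 * lam"
    by (rule power2_eq_imp_eq) (use F_ge[OF p] lam in auto)
next
  assume "F p = 4 * lam"
  then have "\<bar>F_deriv p X\<bar> \<le> 0" for X
    using F_deriv_le[OF p, of X] by simp
  then show "critical_point F p"
    by (simp add: critical_point_def frechet_derivative_F p)
qed

lemma continuous_on_F: "continuous_on half_space F"
  using F_has_derivative has_derivative_continuous continuous_at_imp_continuous_on by blast

lemma arcosh_le_length:
  assumes \<gamma>: "valid_path \<gamma>" "path_image \<gamma> \<subseteq> half_space" and q: "F (pathfinish \<gamma>) = 4 * lam"
    and L: "((\<lambda>u. metric_norm metric (\<gamma> u) (vector_derivative \<gamma> (at u))) has_integral L) {0..1}"
  shows "arcosh (F (pathstart \<gamma>) / (4 * lam)) \<le> L"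
proof (rule field_le_epsilon)
  fix \<eta> :: real
  assume \<eta>: "\<eta> > 0"
  \<comment> \<open>The shift by \<open>\<delta>\<close> keeps \<open>arcosh\<close> away from its singularity at \<open>1\<close>.\<close>
  define \<delta> where "\<delta> = cosh \<eta> - 1"
  have \<delta>: "\<delta> > 0"
    using \<eta> cosh_real_strict_mono[of 0 \<eta>] by (simp add: \<delta>_def)
  define speed where "speed = (\<lambda>u. metric_norm metric (\<gamma> u) (vector_derivative \<gamma> (at u)))"
  define f where "f = (\<lambda>u. arcosh (F (\<gamma> u) / (4 * lam) + \<delta>))"
  define f' where "f' = (\<lambda>u. 1 / sqrt ((F (\<gamma> u) / (4 * lam) + \<delta>)\<^sup>2 - 1)
    * (F_deriv (\<gamma> u) (vector_derivative \<gamma> (at u)) / (4 * lam)))"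
  obtain S where S: "finite S" and contg: "continuous_on {0..1} \<gamma>"
    and diff: "\<And>u. u \<in> {0..1} - S \<Longrightarrow> \<gamma> differentiable at u"
    using \<gamma>(1) by (auto simp: valid_path_def piecewise_C1_differentiable_on_def C1_differentiable_on_eq)
  have hs: "\<gamma> u \<in> half_space" if "u \<in> {0..1}" for u
    using \<gamma>(2) that by (auto simp: path_image_def)
  have ge1: "F (\<gamma> u) / (4 * lam) \<ge> 1" if "u \<in> {0..1}" for u
    using F_ge[OF hs[OF that]] lam by (simp add: divide_simps)
  have contf: "continuous_on {0..1} f"
    unfolding f_def
  proof (intro continuous_intros)
    show "continuous_on {0..1} (\<lambda>u. F (\<gamma> u))"
      using continuous_on_compose2[OF continuous_on_F contg] hs by blast
    show "1 \<le> F (\<gamma> u) / (4 * lam) + \<delta>" if "u \<in> {0..1}" for u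
      using ge1[OF that] \<delta> by simp
  qed (use lam in simp)
  have deriv: "(f has_vector_derivative f' u) (at u)" if u: "u \<in> {0..1} - S" for u
  proof -
    have g: "(\<gamma> has_derivative (\<lambda>h. h *\<^sub>R vector_derivative \<gamma> (at u))) (at u)"
      using diff[OF u] by (simp add: vector_derivative_works has_vector_derivative_def)
    have "((\<lambda>u. F (\<gamma> u)) has_derivative (\<lambda>h. F_deriv (\<gamma> u) (h *\<^sub>R vector_derivative \<gamma> (at u)))) (at u)"
      using has_derivative_compose[OF g F_has_derivative] hs u by simp
    moreover have "(\<lambda>h. F_deriv (\<gamma> u) (h *\<^sub>R vector_derivative \<gamma> (at u)))
        = (*) (F_deriv (\<gamma> u) (vector_derivative \<gamma> (at u)))"
      using linear_cmul[OF linear_F_deriv[OF hs]] u by (simp add: fun_eq_iff mult.commute)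
    ultimately have "((\<lambda>u. F (\<gamma> u)) has_real_derivative F_deriv (\<gamma> u) (vector_derivative \<gamma> (at u))) (at u)"
      by (simp add: has_field_derivative_def)
    then have 1: "((\<lambda>u. F (\<gamma> u) / (4 * lam) + \<delta>) has_real_derivative
        F_deriv (\<gamma> u) (vector_derivative \<gamma> (at u)) / (4 * lam)) (at u)"
      using lam by (auto intro!: derivative_eq_intros)
    have "F (\<gamma> u) / (4 * lam) + \<delta> > 1"
      using ge1[of u] u \<delta> by simp
    then show ?thesis
      unfolding f_def f'_def has_real_derivative_iff_has_vector_derivative[symmetric]
      by (rule DERIV_chain2[OF arcosh_real_has_field_derivative 1])
  qed
  \<comment> \<open>The bound holds for every vector in place of the velocity, so the exceptional
    parameters need no separate treatment. Enlarging x to x + \<delta> only increases the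
    denominator of f', which preserves the unit gradient bound.\<close>
  have bound: "- f' u \<le> speed u" if u: "u \<in> {0..1}" for u
  proof -
    define x where "x = F (\<gamma> u) / (4 * lam)"
    have x: "x \<ge> 1"
      using ge1[OF u] by (simp add: x_def)
    have pos: "sqrt ((x + \<delta>)\<^sup>2 - 1) > 0"
      using x \<delta> by (simp add: one_less_power)
    have "sqrt ((F (\<gamma> u))\<^sup>2 - 16 * lam\<^sup>2) = sqrt ((4 * lam)\<^sup>2 * (x\<^sup>2 - 1))"
      using lam by (simp add: x_def power2_eq_square field_simps)
    also have "\<dots> = 4 * lam * sqrt (x\<^sup>2 - 1)"
      unfolding real_sqrt_mult using lam by (subst real_sqrt_unique[of "4 * lam"]) auto
    also have "\<dots> \<le> 4 * lam * sqrt ((x + \<delta>)\<^sup>2 - 1)"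
      using x \<delta> lam by (intro mult_left_mono real_sqrt_le_mono diff_right_mono power_mono) auto
    finally have "sqrt ((F (\<gamma> u))\<^sup>2 - 16 * lam\<^sup>2) * speed u \<le> 4 * lam * sqrt ((x + \<delta>)\<^sup>2 - 1) * speed u"
      by (rule mult_right_mono) (simp add: speed_def metric_norm_eq[OF hs[OF u]])
    with F_deriv_le[OF hs[OF u], of "vector_derivative \<gamma> (at u)"]
    have "- F_deriv (\<gamma> u) (vector_derivative \<gamma> (at u)) \<le> 4 * lam * sqrt ((x + \<delta>)\<^sup>2 - 1) * speed u"
      by (simp add: speed_def)
    moreover have "4 * lam * sqrt ((x + \<delta>)\<^sup>2 - 1) > 0"
      using pos lam by simp
    moreover have "- f' u = - F_deriv (\<gamma> u) (vector_derivative \<gamma> (at u)) / (4 * lam * sqrt ((x + \<delta>)\<^sup>2 - 1))"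
      by (simp add: f'_def x_def)
    ultimately show ?thesis
      by (simp only: pos_divide_le_eq mult.commute)
  qed
  have "(f' has_integral f 1 - f 0) {0..1}"
    by (rule fundamental_theorem_of_calculus_strong[OF S _ deriv contf]) auto
  then have "((\<lambda>u. - f' u) has_integral - (f 1 - f 0)) {0..1}"
    by (rule has_integral_neg)
  then have "- (f 1 - f 0) \<le> L"
    using L bound unfolding speed_def by (rule has_integral_le)
  \<comment> \<open>At the end of the path the argument of \<open>arcosh\<close> is 1 + \<delta> =
    cosh \<eta>, by the choice of \<delta>; this is the whole loss in the estimate.\<close>
  moreover have "f 1 = \<eta>"
    using q lam \<eta> by (simp add: f_def pathfinish_def \<delta>_def arcosh_cosh_real)
  moreover have "arcosh (F (pathstart \<gamma>) / (4 * lam)) \<le> f 0"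
  proof -
    have "1 \<le> F (\<gamma> 0) / (4 * lam)"
      using ge1[of 0] by simp
    then show ?thesis
      unfolding f_def pathstart_def
      by (rule less_imp_le[OF arcosh_real_strict_mono]) (use \<delta> in simp)
  qed
  ultimately show "arcosh (F (pathstart \<gamma>) / (4 * lam)) \<le> L + \<eta>"
    by simp
qed

section \<open>Riemannian distance and the radius of the tube\<close>

definition lengths :: "'v \<times> 'z \<times> real \<Rightarrow> 'v \<times> 'z \<times> real \<Rightarrow> real set" where
  "lengths p q = {L. \<exists>\<gamma>. valid_path \<gamma> \<and> path_image \<gamma> \<subseteq> half_space
      \<and> pathstart \<gamma> = p \<and> pathfinish \<gamma> = q
      \<and> ((\<lambda>s. metric_norm metric (\<gamma> s) (vector_derivative \<gamma> (at s))) has_integral L) {0..1}}"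

text \<open>A lower bound on \<open>Inf\<close> over the reals requires a nonempty set. The straight
  segment stays in the half-space by convexity and has continuous speed, hence a length.\<close>

lemma lengths_nonempty:
  assumes "p \<in> half_space" "q \<in> half_space"
  shows "lengths p q \<noteq> {}"
proof -
  have im: "path_image (linepath p q) \<subseteq> half_space"
    unfolding path_image_linepath by (rule closed_segment_subset[OF assms convex_half_space])
  have "continuous_on half_space (\<lambda>a. metric a X X)" for X
    by (intro continuous_at_imp_continuous_on ballI
        has_derivative_continuous[OF metric_const_has_derivative])
  then have "continuous_on half_space (\<lambda>a. metric_norm metric a (q - p))"
    unfolding metric_norm_def by (rule continuous_on_real_sqrt)
  then have "continuous_on {0..1} (\<lambda>s. metric_norm metric (linepath p q s) (q - p))"
    using continuous_on_linepath im unfolding path_image_def by (rule continuous_on_compose2)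
  then have "(\<lambda>s. metric_norm metric (linepath p q s) (q - p)) integrable_on {0..1}"
    by (rule integrable_continuous_real)
  then obtain L where
    "((\<lambda>s. metric_norm metric (linepath p q s) (vector_derivative (linepath p q) (at s))) has_integral L) {0..1}"
    unfolding vector_derivative_linepath_at integrable_on_def by (rule exE)
  then have "L \<in> lengths p q"
    unfolding lengths_def using im
    by (intro CollectI exI[of _ "linepath p q"] conjI valid_path_linepath pathstart_linepath pathfinish_linepath)
  then show ?thesis
    by blast
qed

lemma lengths_ge:
  assumes "F q = 4 * lam" "L \<in> lengths p q"
  shows "arcosh (F p / (4 * lam)) \<le> L"
proof -
  obtain \<gamma> where "valid_path \<gamma>" "path_image \<gamma> \<subseteq> half_space" "pathstart \<gamma> = p" "pathfinish \<gamma> = q"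
    "((\<lambda>s. metric_norm metric (\<gamma> s) (vector_derivative \<gamma> (at s))) has_integral L) {0..1}"
    using assms(2) unfolding lengths_def mem_Collect_eq by (elim exE conjE)
  then show ?thesis
    using arcosh_le_length[of \<gamma> L] assms(1) by simp
qed

lemma riemannian_dist_eq_Inf: "riemannian_dist metric half_space p q = Inf (lengths p q)"
  by (simp add: riemannian_dist_def lengths_def)

lemma riemannian_dist_ge:
  assumes "p \<in> half_space" "q \<in> half_space" "F q = 4 * lam"
  shows "arcosh (F p / (4 * lam)) \<le> riemannian_dist metric half_space p q"
  unfolding riemannian_dist_eq_Inf
  using lengths_nonempty[OF assms(1,2)] lengths_ge[OF assms(3)] by (rule cInf_greatest)

text \<open>The geodesic is traversed affinely in t, as a \<open>linepath\<close>; its speed is the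
  logarithmic derivative of the height up to sign, so its length is still the difference of
  logarithms.\<close>

lemma vertical_length:
  assumes "0 < t0" "t0 \<le> t1"
  shows "ln (t1 / t0) \<in> lengths (v, z, t1) (v, z, t0)"
proof -
  let ?\<gamma> = "linepath (v, z, t1) (v, z, t0)"
  define h where "h = (\<lambda>u. (1 - u) * t1 + u * t0)"
  have h: "h u > 0" if "u \<in> {0..1}" for u
  proof -
    have "h u = t0 + (1 - u) * (t1 - t0)"
      by (simp add: h_def algebra_simps)
    then show ?thesis
      using assms that by (simp add: add_pos_nonneg)
  qed
  have g: "?\<gamma> u = (v, z, h u)" for u
    by (simp add: linepath_def h_def flip: scaleR_add_left)
  have speed: "metric_norm metric (?\<gamma> u) (vector_derivative ?\<gamma> (at u)) = (t1 - t0) / h u"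
    if "u \<in> {0..1}" for u
    using h[OF that] assms
    by (simp add: g metric_norm_def dr_metric_def br.zero_left real_sqrt_divide
        flip: power2_eq_square)
  have "((\<lambda>u. (t1 - t0) / h u) has_integral (- ln (h 1) - - ln (h 0))) {0..1}"
  proof (rule fundamental_theorem_of_calculus)
    fix u :: real assume u: "u \<in> {0..1}"
    have "(h has_real_derivative t0 - t1) (at u within {0..1})"
      unfolding h_def by (auto intro!: derivative_eq_intros)
    then have "((\<lambda>u. - ln (h u)) has_real_derivative (t1 - t0) / h u) (at u within {0..1})"
      using h[OF u] by (auto intro!: derivative_eq_intros simp: divide_simps)
    then show "((\<lambda>u. - ln (h u)) has_vector_derivative (t1 - t0) / h u) (at u within {0..1})"
      by (simp add: has_real_derivative_iff_has_vector_derivative)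
  qed simp
  also have "- ln (h 1) - - ln (h 0) = ln (t1 / t0)"
    using assms by (simp add: h_def ln_div)
  finally have "((\<lambda>u. metric_norm metric (?\<gamma> u) (vector_derivative ?\<gamma> (at u)))
      has_integral ln (t1 / t0)) {0..1}"
    by (rule has_integral_eq[rotated]) (rule speed[symmetric])
  moreover have "path_image ?\<gamma> \<subseteq> half_space"
    using h by (auto simp: path_image_def g half_space_def)
  ultimately show ?thesis
    unfolding lengths_def by (intro CollectI exI[of _ ?\<gamma>]) simp
qed

lemma F_vertical: "t > 0 \<Longrightarrow> F (v0, z0, t) = t + 4 * lam\<^sup>2 / t"
  by (simp add: F_eq shift_eq br_self numer_def height_def divide_simps power2_eq_square)

lemma tube_radius:
  assumes Foc: "Foc = level_set half_space F (4 * lam)"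
    and c: "c \<ge> 4 * lam" and tube: "level_set half_space F c \<subseteq> tube metric half_space Foc r"
  shows "cosh r = c / (4 * lam)"
proof -
  define s where "s = arcosh (c / (4 * lam))"
  have c1: "c / (4 * lam) \<ge> 1"
    using c lam by simp
  have s: "s \<ge> 0" and cosh_s: "cosh s = c / (4 * lam)"
    using c1 by (simp_all add: s_def)
  \<comment> \<open>On this vertical line F = t + 4 lam^2 / t has its minimum 4 lam at t = 2 lam,
    and the factor e^s raises it to 4 lam cosh s. The segment from p to q has length s, matching the
    lower bound.\<close>
  define p q where "p = (v0, z0, 2 * lam * exp s)" and "q = (v0, z0, 2 * lam)"
  have hs: "p \<in> half_space" "q \<in> half_space"
    using lam by (simp_all add: p_def q_def half_space_def)
  have "F p = 4 * lam * cosh s"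
    using lam by (simp add: p_def F_vertical cosh_def exp_minus power2_eq_square field_simps)
  then have Fp: "F p = c"
    using cosh_s lam by simp
  have Fq: "F q = 4 * lam"
    using lam by (simp add: q_def F_vertical power2_eq_square)
  have q: "q \<in> Foc"
    using hs Fq by (simp add: Foc level_set_def)
  have lower: "s \<le> riemannian_dist metric half_space p x" if "x \<in> Foc" for x
    using riemannian_dist_ge[OF hs(1), of x] that by (simp add: Foc level_set_def Fp s_def)
  have "s \<in> lengths p q"
    using vertical_length[of "2 * lam" "2 * lam * exp s" v0 z0] lam s by (simp add: p_def q_def)
  moreover have "bdd_below (lengths p q)"
    unfolding s_def Fp[symmetric] using lengths_ge[OF Fq] by (rule bdd_belowI)
  ultimately have "riemannian_dist metric half_space p q \<le> s"
    unfolding riemannian_dist_eq_Inf by (rule cInf_lower)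
  moreover have "riemannian_dist_set metric half_space p Foc \<le> riemannian_dist metric half_space p q"
    unfolding riemannian_dist_set_def using q lower by (intro cINF_lower bdd_belowI2[of _ s])
  moreover have "s \<le> riemannian_dist_set metric half_space p Foc"
    unfolding riemannian_dist_set_def using q lower by (intro cINF_greatest) auto
  moreover have "riemannian_dist_set metric half_space p Foc = r"
    using tube hs Fp by (auto simp: tube_def level_set_def)
  ultimately have "r = s"
    by simp
  then show ?thesis
    using cosh_s by simp
qed

subsection \<open>The trace of the Weingarten operator\<close>

text \<open>A basis adapted to the splitting diagonalises \<open>sig\<close>, so that its trace can
  be read off as the difference of the two dimensions.\<close>

lemma decomp_basis:
  obtains Bp Bm where "finite Bp" "finite Bm" "orthonormal (Bp \<union> Bm)" "span (Bp \<union> Bm) = UNIV"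
    "Bp \<subseteq> Vp" "Bm \<subseteq> Vm" "Bp \<inter> Bm = {}" "card Bp = dim Vp" "card Bm = dim Vm"
proof -
  obtain Bp where p: "finite Bp" "orthonormal Bp" "span Bp = Vp"
    using orthonormal_basis_exists[OF finite_dimensional_subspace[OF finite_dimensional_v subspace_p]] .
  obtain Bm where m: "finite Bm" "orthonormal Bm" "span Bm = Vm"
    using orthonormal_basis_exists[OF finite_dimensional_subspace[OF finite_dimensional_v subspace_m]] .
  have sub: "Bp \<subseteq> Vp" "Bm \<subseteq> Vm"
    using p(3) m(3) span_superset by blast+
  have "span (Bp \<union> Bm) = UNIV"
  proof -
    have "v \<in> span (Bp \<union> Bm)" for v
    proof -
      obtain x y where "x \<in> span Bp" "y \<in> span Bm" "v = x + y"
        using p(3) m(3) by (metis decompE)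
      then show ?thesis
        by (auto simp: span_Un)
    qed
    then show ?thesis
      by blast
  qed
  moreover have "orthonormal (Bp \<union> Bm)" "Bp \<inter> Bm = {}"
    using orthonormal_Un[OF p(1,2) m(1,2)] decomp_orthogonal sub by blast+
  ultimately show thesis
    using that[of Bp Bm] p m sub orthonormal_card[OF p(1,2)] orthonormal_card[OF m(1,2)] by simp
qed

lemma linear_grad_deriv: "linear (grad_deriv p)"
  using has_derivative_linear[OF grad_has_derivative] .

lemma base_in_half_space: "(v0, z0, 1) \<in> half_space"
  by (simp add: half_space_def)

text \<open>Conjugation by the frame at the base point does not change the trace, so the divergence
  is that of \<open>grad_base\<close>. The rank-one contribution |w|^2 / 2 and the t-direction's 2 t
  combine to 2 height; the v and z directions add n height and 2 m height, and \<open>sig\<close>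
  adds the dimension difference.\<close>

lemma trace_grad_deriv:
  "trace_on UNIV (grad_deriv p)
    = height (shift p) * (real (dim (UNIV :: 'v set)) + 2 * real (dim (UNIV :: 'z set)) + 2)
      + 2 * lam * (real (dim Vp) - real (dim Vm))"
proof -
  obtain w \<zeta> t where sh: "shift p = (w, \<zeta>, t)"
    by (cases "shift p")
  define h where "h = height (w, \<zeta>, t)"
  obtain Bp Bm where Bp: "finite Bp" "Bp \<subseteq> Vp" "card Bp = dim Vp"
    and Bm: "finite Bm" "Bm \<subseteq> Vm" "card Bm = dim Vm"
    and A': "orthonormal (Bp \<union> Bm)" "span (Bp \<union> Bm) = UNIV" and disj: "Bp \<inter> Bm = {}"
    by (rule decomp_basis)
  define A where "A = Bp \<union> Bm"
  have A: "finite A" "orthonormal A" "span A = UNIV"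
    using Bp(1) Bm(1) A' by (simp_all add: A_def)
  obtain B :: "'z set" where B: "finite B" "orthonormal B" "span B = UNIV"
    using orthonormal_basis_exists[OF finite_dimensional_z] .
  note AB = prod_basis_orthonormal[OF A B]
  have a: "grad_base_deriv (w, \<zeta>, t) (a, 0, 0) \<bullet> (a, 0, 0)
      = (w \<bullet> a) * (w \<bullet> a) / 2 + h + 2 * lam * (sig a \<bullet> a)" if "a \<in> A" for a
    using that A(2) by (simp add: grad_base_deriv_def J.zero_left inner_simps J_self orthonormal_def
        flip: h_def)
  have b: "grad_base_deriv (w, \<zeta>, t) (0, b, 0) \<bullet> (0, b, 0) = 2 * h" if "b \<in> B" for b
    using that B(2) by (simp add: grad_base_deriv_def orthonormal_def flip: h_def)
  have c: "grad_base_deriv (w, \<zeta>, t) (0, 0, 1) \<bullet> (0, 0, 1) = 2 * t"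
    by (simp add: grad_base_deriv_def numer_deriv_def)
  have "(\<Sum>a\<in>A. sig a \<bullet> a) = (\<Sum>a\<in>Bp. sig a \<bullet> a) + (\<Sum>a\<in>Bm. sig a \<bullet> a)"
    unfolding A_def by (rule sum.union_disjoint[OF Bp(1) Bm(1) disj])
  also have "(\<Sum>a\<in>Bp. sig a \<bullet> a) = (\<Sum>a\<in>Bp. 1)"
    using A(2) Bp(2) by (intro sum.cong) (auto simp: sig_p A_def orthonormal_def)
  also have "(\<Sum>a\<in>Bm. sig a \<bullet> a) = (\<Sum>a\<in>Bm. - 1)"
    using A(2) Bm(2) by (intro sum.cong) (auto simp: sig_m A_def orthonormal_def)
  finally have trace_sig: "(\<Sum>a\<in>A. sig a \<bullet> a) = real (dim Vp) - real (dim Vm)"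
    by (simp add: Bp(3) Bm(3))
  have "trace_on UNIV (grad_deriv p)
      = (\<Sum>u\<in>prod_basis A B. coframe (v0, z0, 1) (grad_deriv p (frame (v0, z0, 1) u)) \<bullet> u)"
    by (rule trace_on_UNIV_orthonormal[OF AB(1-3) linear_coframe linear_frame _ _ linear_grad_deriv])
      (simp_all only: coframe_frame frame_coframe base_in_half_space)
  also have "\<dots> = (\<Sum>u\<in>prod_basis A B. grad_base_deriv (w, \<zeta>, t) u \<bullet> u)"
    by (simp only: grad_deriv_def coframe_frame[OF base_in_half_space] sh)
  also have "\<dots> = (\<Sum>a\<in>A. (w \<bullet> a) * (w \<bullet> a) / 2 + h + 2 * lam * (sig a \<bullet> a)) + (\<Sum>b\<in>B. 2 * h) + 2 * t"
    by (simp only: AB(4) a b c cong: sum.cong)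
  also have "\<dots> = (w \<bullet> w) / 2 + real (card A) * h + 2 * lam * (real (dim Vp) - real (dim Vm))
      + real (card B) * (2 * h) + 2 * t"
  proof -
    have "(\<Sum>a\<in>A. (w \<bullet> a) * (w \<bullet> a) / 2) = (w \<bullet> w) / 2"
      using orthonormal_Parseval[OF A(1,2), of w w] A(3) by (simp flip: sum_divide_distrib)
    then show ?thesis
      by (simp add: sum.distrib trace_sig flip: sum_distrib_left)
  qed
  also have "card A = dim (UNIV :: 'v set)"
    using orthonormal_card[OF A(1,2)] A(3) by simp
  also have "card B = dim (UNIV :: 'z set)"
    using orthonormal_card[OF B(1,2)] B(3) by simp
  finally show ?thesis
    by (simp add: sh height_def h_def algebra_simps)
qed

lemma unit_normal_F:
  "p \<in> half_space \<Longrightarrow> unit_normal metric F p = (1 / sqrt ((F p)\<^sup>2 - 16 * lam\<^sup>2)) *\<^sub>R grad p"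
  by (simp add: unit_normal_def gradient_F metric_norm_grad divide_inverse)

lemma F_norm_pos:
  assumes "p \<in> half_space" "F p \<noteq> 4 * lam"
  shows "(F p)\<^sup>2 - 16 * lam\<^sup>2 > 0"
proof -
  have "4 * lam < F p"
    using F_ge[OF assms(1)] assms(2) by simp
  then have "(4 * lam)\<^sup>2 < (F p)\<^sup>2"
    using lam by (intro power_strict_mono) auto
  then show ?thesis
    by (simp add: power_mult_distrib)
qed

lemma unit_normal_has_derivative:
  assumes p: "p \<in> half_space" and reg: "F p \<noteq> 4 * lam"
  defines "\<beta> \<equiv> (F p)\<^sup>2 - 16 * lam\<^sup>2"
  shows "(unit_normal metric F has_derivative
    (\<lambda>X. (- F p * F_deriv p X / (\<beta> * sqrt \<beta>)) *\<^sub>R grad p + (1 / sqrt \<beta>) *\<^sub>R grad_deriv p X)) (at p)"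
proof -
  have \<beta>: "\<beta> > 0"
    using F_norm_pos[OF p reg] by (simp add: \<beta>_def)
  note F_has_derivative[OF p, derivative_intros]
  have "((\<lambda>q. 1 / sqrt ((F q)\<^sup>2 - 16 * lam\<^sup>2)) has_derivative (\<lambda>X. - F p * F_deriv p X / (\<beta> * sqrt \<beta>))) (at p)"
    by (rule derivative_eq_intros refl | (use \<beta> in \<open>simp add: \<beta>_def; fail\<close>))+
      (use \<beta> in \<open>simp add: fun_eq_iff divide_simps flip: \<beta>_def\<close>)
  from has_derivative_scaleR[OF this grad_has_derivative]
  have "((\<lambda>q. (1 / sqrt ((F q)\<^sup>2 - 16 * lam\<^sup>2)) *\<^sub>R grad q) has_derivative
    (\<lambda>X. (- F p * F_deriv p X / (\<beta> * sqrt \<beta>)) *\<^sub>R grad p + (1 / sqrt \<beta>) *\<^sub>R grad_deriv p X)) (at p)"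
    by (simp add: \<beta>_def add.commute)
  \<comment> \<open>The closed formula for the unit normal holds only inside
    \<open>half_space\<close>, so the derivative is transferred through this open set.\<close>
  then show ?thesis
    by (rule has_derivative_transform_within_open[OF _ open_half_space p]) (simp add: unit_normal_F)
qed

lemma metric_unit_normal:
  assumes "p \<in> half_space" "F p \<noteq> 4 * lam"
  shows "metric p (unit_normal metric F p) (unit_normal metric F p) = 1"
  using F_norm_pos[OF assms]
  by (simp add: unit_normal_F metric_left_simps metric_commute[of p "grad p" "_ *\<^sub>R _"]
      metric_grad_grad assms)

text \<open>Differentiating g(N, N) = 1 with metric compatibility makes the covariant derivative of
  N orthogonal to N, that is, tangent to the level set. It holds for every direction X, as the
  passage from the tangent space to the full trace requires.\<close>

lemma F_deriv_cov_deriv_unit_normal: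
  assumes p: "p \<in> half_space" and reg: "F p \<noteq> 4 * lam"
  shows "F_deriv p (cov_deriv metric (unit_normal metric F) p X) = 0"
proof -
  let ?N = "unit_normal metric F"
  obtain N' where N': "(?N has_derivative N') (at p)"
    using unit_normal_has_derivative[OF p reg] by blast
  have "eventually (\<lambda>q. q \<in> half_space) (at p)"
    using p open_half_space unfolding eventually_at_topological by blast
  moreover have "eventually (\<lambda>q. 4 * lam < F q) (at p)"
    using has_derivative_continuous[OF F_has_derivative[OF p]] F_ge[OF p] reg
    by (intro order_tendstoD(1)[of F "F p"]) (auto simp: isCont_def)
  \<comment> \<open>N has length 1 only where F > 4 lam, so the identity to be differentiated is
    available near p but not globally.\<close>
  ultimately have ev: "eventually (\<lambda>q. metric q (?N q) (?N q) = 1) (at p)"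
    by eventually_elim (rule metric_unit_normal, auto)
  have "((\<lambda>q. 1 :: real) has_derivative (\<lambda>X. metric_deriv p X (?N p) (?N p)
      + metric p (N' X) (?N p) + metric p (?N p) (N' X))) (at p)"
    using metric_has_derivative[OF p N' N'] ev metric_unit_normal[OF p reg]
    by (rule has_derivative_transform_eventually) simp_all
  from has_derivative_unique[OF this has_derivative_const]
  have "metric_deriv p X (?N p) (?N p) + metric p (N' X) (?N p) + metric p (?N p) (N' X) = 0"
    by (rule fun_cong)
  then have "metric p (cov_deriv metric ?N p X) (?N p) = 0"
    using frechet_derivative_at[OF N', symmetric]
    by (simp add: cov_deriv_def metric_left_simps metric_christoffel_right[OF p]
        metric_commute[of p "?N p" "N' X"])
  then have "metric p (grad p) (cov_deriv metric ?N p X) = 0"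
    using F_norm_pos[OF p reg]
    by (simp add: unit_normal_F p metric_commute[of p "cov_deriv _ _ _ _"] metric_left_simps)
  then show ?thesis
    by (simp add: metric_grad p)
qed

lemma trace_weingarten:
  assumes p: "p \<in> half_space" and reg: "F p \<noteq> 4 * lam"
  shows "trace_on (tangent_space F p) (weingarten metric (unit_normal metric F) p)
    = - ((real (dim (UNIV :: 'v set)) / 2 + real (dim (UNIV :: 'z set))) * F p
         + 2 * lam * (real (dim Vp) - real (dim Vm))) / sqrt ((F p)\<^sup>2 - 16 * lam\<^sup>2)"
proof -
  let ?N = "unit_normal metric F"
  obtain v z t where pe: "p = (v, z, t)" and t: "t > 0"
    using p by (auto simp: half_space_def)
  define \<beta> where "\<beta> = (F p)\<^sup>2 - 16 * lam\<^sup>2"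
  have \<beta>: "\<beta> > 0"
    using F_norm_pos[OF p reg] by (simp add: \<beta>_def)
  define f where "f = (\<lambda>X. - F p * F_deriv p X / (\<beta> * sqrt \<beta>))"
  define \<Gamma> where "\<Gamma> = (\<lambda>X. christoffel metric p X (?N p))"
  have cov: "cov_deriv metric ?N p = (\<lambda>X. (f X *\<^sub>R grad p + (1 / sqrt \<beta>) *\<^sub>R grad_deriv p X) + \<Gamma> X)"
    using frechet_derivative_at[OF unit_normal_has_derivative[OF p reg]]
    by (simp add: cov_deriv_def f_def \<Gamma>_def \<beta>_def fun_eq_iff)
  have lf: "linear f"
    using linear_F_deriv[OF p] unfolding f_def
    by (intro linearI) (simp_all add: linear_add linear_cmul algebra_simps add_divide_distrib diff_divide_distrib)
  have l1: "linear (\<lambda>X. f X *\<^sub>R grad p)"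
    using lf by (intro linearI) (simp_all add: linear_add linear_cmul algebra_simps)
  have l2: "linear (\<lambda>X. (1 / sqrt \<beta>) *\<^sub>R grad_deriv p X)"
    by (intro linear_compose_scale_right linear_grad_deriv)
  have l3: "linear \<Gamma>"
    unfolding \<Gamma>_def by (rule linear_christoffel[OF p])
  have lin: "linear (cov_deriv metric ?N p)"
    unfolding cov by (intro linear_compose_add l1 l2 l3)
  have "F_deriv p (grad p) = \<beta>"
    using metric_grad_grad[OF p] by (simp add: metric_grad p \<beta>_def)
  then have fg: "f (grad p) = - F p / sqrt \<beta>" "F_deriv p (grad p) \<noteq> 0"
    using \<beta> by (simp_all add: f_def)
  have "snd (snd (grad p)) = 2 * t * height (shift p) - numer (shift p)"
    by (simp add: pe shift_eq grad_def grad_base_def frame_base)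
  then have Np: "?N p = (fst (?N p), fst (snd (?N p)), (2 * t * height (shift p) - numer (shift p)) / sqrt \<beta>)"
    by (simp add: prod_eq_iff unit_normal_F[OF p] \<beta>_def)
  have "trace_on (tangent_space F p) (weingarten metric ?N p)
      = trace_on (tangent_space F p) (\<lambda>X. (-1) *\<^sub>R cov_deriv metric ?N p X)"
    by (simp add: weingarten_def[abs_def])
  \<comment> \<open>The tangent space is the kernel of \<open>F_deriv p\<close>, and
    \<open>grad p\<close> is transversal to it because dF(grad F) = \<beta> > 0.\<close>
  also have "\<dots> = trace_on UNIV (\<lambda>X. (-1) *\<^sub>R cov_deriv metric ?N p X)"
    by (rule trace_on_hyperplane[OF finite_dimensional_tangent linear_F_deriv[OF p] fg(2)])
      (simp_all add: tangent_space_def frechet_derivative_F p linear_compose_neg[OF lin]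
        F_deriv_cov_deriv_unit_normal[OF p reg] linear_neg[OF linear_F_deriv[OF p]])
  also have "\<dots> = - trace_on UNIV (cov_deriv metric ?N p)"
    using trace_on_UNIV_scaleR[OF finite_dimensional_tangent lin, of "-1"] by simp
  also have "trace_on UNIV (cov_deriv metric ?N p)
      = f (grad p) + 1 / sqrt \<beta> * trace_on UNIV (grad_deriv p) + trace_on UNIV \<Gamma>"
    unfolding cov
    by (simp only: trace_on_UNIV_add finite_dimensional_tangent l1 l2 l3 linear_compose_add
        trace_on_UNIV_scaleR linear_grad_deriv trace_on_UNIV_rank_one lf)
  also have "trace_on UNIV \<Gamma> = - (real (dim (UNIV :: 'v set)) / 2 + real (dim (UNIV :: 'z set)) + 1)
      * ((2 * t * height (shift p) - numer (shift p)) / sqrt \<beta>) / t"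
    unfolding \<Gamma>_def by (rule trace_christoffel[OF pe t Np])
  also have "(2 * t * height (shift p) - numer (shift p)) / sqrt \<beta>
      = t * (2 * height (shift p) - F p) / sqrt \<beta>"
    using t by (simp add: F_eq pe algebra_simps)
  \<comment> \<open>The height cancels: (n + 2 m + 2) height from the flat divergence against (n/2 +
    m + 1) times 2 height from the density. Of the remaining (n/2 + m + 1) F, the rank-one term - F
    removes one copy.\<close>
  finally show ?thesis
    unfolding trace_grad_deriv fg \<beta>_def[symmetric] using \<beta> t
    by (simp add: add_divide_distrib diff_divide_distrib algebra_simps)
qed

end

theorem proposition6p3:
  fixes J :: "'z::real_inner \<Rightarrow> 'v::real_inner \<Rightarrow> 'v"
    and Vp Vm v0 z0 lam r Foc \<Sigma> n m np nm g F
  assumes data: "damek_ricci_data J"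
    and n: "n = dim (UNIV :: 'v set)"
    and m: "m = dim (UNIV :: 'z set)"
    and g: "g = dr_metric J"
    and submod_p: "clifford_submodule J Vp"
    and submod_m: "clifford_submodule J Vm"
    and decomp: "orthogonal_decomposition Vp Vm"
    and np: "np = dim Vp"
    and nm: "nm = dim Vm"
    and lam: "lam > 0"
    and F: "F = isoparam_fun J Vp Vm v0 z0 lam"
    and focal: "focal_variety half_space F Foc"
    and reg: "regular_level_set half_space F \<Sigma>"
    and r: "r > 0"
    and tube: "\<Sigma> = tube g half_space Foc r"
  shows "\<forall>p\<in>\<Sigma>. trace_on (tangent_space F p) (weingarten g (unit_normal g F) p)
           = - (real m + real n / 2) * coth r - 1/2 * (real np - real nm) * (1 / sinh r)"
proof
  interpret I: isoparametric J Vp Vm v0 z0 lam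
    by unfold_locales fact+
  have F': "F = I.F"
    by (simp add: F I.F_def)
  obtain c0 p0 where c0: "Foc = level_set half_space F c0" "p0 \<in> Foc" "critical_point F p0"
    using focal by (auto simp: focal_variety_def)
  \<comment> \<open>A focal variety is given as some singular level; having a critical point pins
    the level to the minimum.\<close>
  then have "c0 = 4 * lam"
    using I.critical_point_iff[of p0] by (auto simp: level_set_def F')
  then have Foc: "Foc = level_set half_space I.F (4 * lam)"
    using c0(1) by (simp add: F')
  obtain c where c: "c \<in> F ` half_space" "\<Sigma> = level_set half_space F c"
    using reg by (auto simp: regular_level_set_def)
  have "c \<ge> 4 * lam"
    using c(1) I.F_ge by (auto simp: F')
  moreover have "level_set half_space I.F c \<subseteq> tube (dr_metric J) half_space Foc r"
    using tube c(2) by (simp add: F' g)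
  ultimately have cosh_r: "cosh r = c / (4 * lam)"
    by (rule I.tube_radius[OF Foc])
  fix p assume p: "p \<in> \<Sigma>"
  then have ph: "p \<in> half_space" and Fp: "I.F p = 4 * lam * cosh r"
    using c(2) lam cosh_r by (auto simp: level_set_def F')
  have "\<not> critical_point I.F p"
    using reg p by (auto simp: regular_level_set_def F')
  then have "I.F p \<noteq> 4 * lam"
    using I.critical_point_iff[OF ph] by simp
  from I.trace_weingarten[OF ph this]
  have trace: "trace_on (tangent_space F p) (weingarten g (unit_normal g F) p)
      = - ((real n / 2 + real m) * (4 * lam * cosh r) + 2 * lam * (real np - real nm))
          / sqrt ((4 * lam * cosh r)\<^sup>2 - 16 * lam\<^sup>2)"
    by (simp add: F' g n m np nm Fp)
  \<comment> \<open>With F = 4 lam cosh r the gradient norm is 4 lam sinh r, the positive root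
    because r > 0. Dividing by it produces coth r, and 2 lam / (4 lam) is the factor 1/2 of the
    second term.\<close>
  have "(4 * lam * cosh r)\<^sup>2 - 16 * lam\<^sup>2 = (4 * lam * sinh r)\<^sup>2"
    by (simp add: power_mult_distrib cosh_square_eq algebra_simps)
  then have "sqrt ((4 * lam * cosh r)\<^sup>2 - 16 * lam\<^sup>2) = 4 * lam * sinh r"
    using lam r by (intro real_sqrt_unique) auto
  moreover have "sinh r > 0"
    using r by simp
  ultimately show "trace_on (tangent_space F p) (weingarten g (unit_normal g F) p)
           = - (real m + real n / 2) * coth r - 1/2 * (real np - real nm) * (1 / sinh r)"
    unfolding trace coth_def using lam
    by (simp add: add_divide_distrib diff_divide_distrib algebra_simps)
qed

end
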